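(* Let $A\in\mathbb{R}^{m\times n}$ have singular values $\sigma_1(A)\ge\sigma_2(A)\ge\cdots$. Let $k\ge 2$ (target rank) and $p\ge 2$ (oversampling parameter) be integers with $r=k+p\le\min(m,n)$, and let $t\ge 1$ be an integer. Let $\Omega\in\mathbb{R}^{n\times r}$ be a Gaussian random matrix, let $Y=A\Omega$, and assume that $Y$ has full column rank almost surely (equivalently, $\operatorname{rank}(A)\ge r$). Let $W$ be the $m\times r$ matrix whose columns form an orthonormal basis for the range of $Y$, let $B=W^TA$, and let $L,D,R$ be the matrices produced by the algorithm RCSVD-QR (defined in the context) with $t$ inner QR iterations, that is, $L=WL_t$, $D=D_t^T$ and $R=R_t$. Then $$\mathbb{E}\bigl[\|A-LDR\|_F\bigr]\le\left(1+\frac{k}{p-1}\right)^{1/2}\left(\sum_{j=k+1}^{n}\sigma_j^2(A)\right)^{1/2},$$ where the expectation is with respect to $\Omega$.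
   Context: All matrices are real. $\|\cdot\|_F$ is the Frobenius norm; $\sigma_j(A)$ is the $j$-th largest singular value of $A$, with $\sigma_j(A)=0$ for $j>\min(m,n)$; $\mathrm{eye}(a,b)$ is the $a\times b$ matrix with ones on the main diagonal and zeros elsewhere. A Gaussian random matrix has independent standard normal entries (zero mean, unit variance). The algorithm RCSVD-QR. Input: $A\in\mathbb{R}^{m\times n}$, a target rank $k\ge 2$, an oversampling parameter $p$, $r=k+p$, and a number $t$ of inner QR iterations. Initialize $R_0=\mathrm{eye}(r,n)$. 1. Generate a Gaussian random matrix $\Omega\in\mathbb{R}^{n\times r}$ and form $Y=A\Omega\in\mathbb{R}^{m\times r}$. 2. Compute a QR factorization $Y=WC$, where $W\in\mathbb{R}^{m\times r}$ has orthonormal columns forming a basis of the range of $Y$ and $C\in\mathbb{R}^{r\times r}$ is upper triangular. 3. Form $B=W^TA\in\mathbb{R}^{r\times n}$. 4. For $j=1,\dots,t$: compute a QR factorization $BR_{j-1}^T=L_jT_j$ with $L_j\in\mathbb{R}^{r\times r}$ orthogonal and $T_j\in\mathbb{R}^{r\times r}$ upper triangular; then compute a (thin) QR factorization $B^TL_j=\widehat R_jD_j$ with $\widehat R_j\in\mathbb{R}^{n\times r}$ having orthonormal columns and $D_j\in\mathbb{R}^{r\times r}$ upper triangular; set $R_j=\widehat R_j^T\in\mathbb{R}^{r\times n}$. 5. Output $L=WL_t$, $D=D_t^T$, $R=R_t$. *)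

theory Defs
  imports
    "HOL-Probability.Probability"
    "Jordan_Normal_Form.Char_Poly"
    "Jordan_Normal_Form.DL_Rank"
begin

definition frobenius_norm :: "real mat \<Rightarrow> real" where
  "frobenius_norm A = sqrt (\<Sum>i<dim_row A. \<Sum>j<dim_col A. (A $$ (i, j))\<^sup>2)"

text \<open>
  The singular values of \<open>A\<close> are the square roots of the eigenvalues of \<open>A\<^sup>T A\<close>,
  counted with algebraic multiplicity (as roots of the characteristic polynomial).
  They are indexed from 1, in descending order, and extended by 0
  beyond \<open>min (dim_row A) (dim_col A)\<close>.
\<close>

definition singular_value :: "real mat \<Rightarrow> nat \<Rightarrow> real" where
  "singular_value A j =
     (if 1 \<le> j \<and> j \<le> min (dim_row A) (dim_col A)
      then sqrt (rev (sorted_list_of_multiset (proots (char_poly (transpose_mat A * A)))) ! (j - 1))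
      else 0)"

definition eye :: "nat \<Rightarrow> nat \<Rightarrow> real mat" where
  "eye a b = mat a b (\<lambda>(i, j). if i = j then 1 else 0)"

definition orthonormal_columns :: "real mat \<Rightarrow> bool" where
  "orthonormal_columns Q \<longleftrightarrow> transpose_mat Q * Q = 1\<^sub>m (dim_col Q)"

text \<open>
  Thin QR factorization \<open>X = Q * C\<close>: \<open>Q\<close> has the shape of \<open>X\<close> and \<open>C\<close> is square.
  If \<open>X\<close> is square, then \<open>Q\<close> is a square matrix with orthonormal columns, i.e. an
  orthogonal matrix. No signs are fixed for the diagonal of \<open>C\<close>, so \<open>Q\<close> and \<open>C\<close> are not
  unique and the factorization is a relation.
\<close>

definition qr_factorization :: "real mat \<Rightarrow> real mat \<Rightarrow> real mat \<Rightarrow> bool" where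
  "qr_factorization X Q C \<longleftrightarrow>
     Q \<in> carrier_mat (dim_row X) (dim_col X) \<and> orthonormal_columns Q \<and>
     C \<in> carrier_mat (dim_col X) (dim_col X) \<and> upper_triangular C \<and>
     X = Q * C"

text \<open>
  \<open>rcsvd_qr A k p t \<Omega> L D R\<close>: on input \<open>A\<close>, \<open>k\<close>, \<open>p\<close>, \<open>t\<close> and with the sampled matrix \<open>\<Omega>\<close>,
  the triple \<open>(L, D, R)\<close> is a possible output of RCSVD-QR, i.e. it arises from some choice
  of the QR factorizations computed on the way.
\<close>

definition rcsvd_qr ::
  "real mat \<Rightarrow> nat \<Rightarrow> nat \<Rightarrow> nat \<Rightarrow> real mat \<Rightarrow> real mat \<Rightarrow> real mat \<Rightarrow> real mat \<Rightarrow> bool" where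
  "rcsvd_qr A k p t \<Omega> L D R \<longleftrightarrow>
     (\<exists>W C B Ls Ts Ds Rh Rs.
        qr_factorization (A * \<Omega>) W C \<and>
        vec_space.col_space (dim_row A) W = vec_space.col_space (dim_row A) (A * \<Omega>) \<and>
        B = transpose_mat W * A \<and>
        Rs 0 = eye (k + p) (dim_col A) \<and>
        (\<forall>j\<in>{1..t}.
           qr_factorization (B * transpose_mat (Rs (j - 1))) (Ls j) (Ts j) \<and>
           qr_factorization (transpose_mat B * Ls j) (Rh j) (Ds j) \<and>
           Rs j = transpose_mat (Rh j)) \<and>
        L = W * Ls t \<and> D = transpose_mat (Ds t) \<and> R = Rs t)"

definition gaussian_random_matrix :: "'w measure \<Rightarrow> nat \<Rightarrow> nat \<Rightarrow> ('w \<Rightarrow> real mat) \<Rightarrow> bool" where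
  "gaussian_random_matrix M n r \<Omega> \<longleftrightarrow>
     (\<forall>\<omega>\<in>space M. \<Omega> \<omega> \<in> carrier_mat n r) \<and>
     (\<forall>i<n. \<forall>j<r. distributed M lborel (\<lambda>\<omega>. \<Omega> \<omega> $$ (i, j)) std_normal_density) \<and>
     prob_space.indep_vars M (\<lambda>_. borel) (\<lambda>(i, j) \<omega>. \<Omega> \<omega> $$ (i, j)) ({..<n} \<times> {..<r})"

text \<open>
  As the outputs \<open>L\<close>, \<open>D\<close>, \<open>R\<close> of the algorithm are only determined up to the choice of the
  QR factorizations, and only on the almost sure event that \<open>A * \<Omega>\<close> has full column rank,
  random quantities built from them need only be measurable up to null sets. Their
  expectation is therefore taken on the completion of the probability space; for functions
  measurable on the space itself it is the usual expectation (\<open>integral_completion\<close>).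
\<close>

abbreviation expectation_compl :: "'w measure \<Rightarrow> ('w \<Rightarrow> real) \<Rightarrow> real" where
  "expectation_compl M X \<equiv> integral\<^sup>L (completion M) X"

end

theory Submission
  imports Defs "HOL-Real_Asymp.Real_Asymp" "Jordan_Normal_Form.Schur_Decomposition"
begin

unbundle no vec_syntax
no_notation inner (infix "\<bullet>" 70)

text \<open>
  The inner QR iterations cancel: \<open>L D R = W W\<^sup>T A\<close>, so the error is the distance of \<open>A\<close> from its
  projection onto the range of \<open>Y = A \<Omega>\<close>, and it is at most \<open>\<parallel>A - Y X\<parallel>\<close> for every \<open>X\<close>.
  Let the columns of \<open>V\<close> be an orthonormal eigenbasis of \<open>A\<^sup>T A\<close>, let \<open>G\<close> consist of the first \<open>k\<close> rows
  of \<open>V\<^sup>T \<Omega>\<close>, and take for \<open>X\<close> the regularised pseudoinverse \<open>G\<^sup>T (G G\<^sup>T + \<epsilon> I)\<^sup>-\<^sup>1\<close>, composed with the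
  projection onto the leading eigenvectors. For \<open>\<epsilon> > 0\<close> it is a bounded smooth function of \<open>\<Omega>\<close>, so both
  expectations that occur, the trace of the regularised inverse and the square of its product with the
  remaining rows of \<open>V\<^sup>T \<Omega>\<close>, follow from Gaussian integration by parts in the entries of \<open>\<Omega>\<close>;
  neither the rotation invariance of the Gaussian law nor the inverse Wishart distribution is needed.
  Finally \<open>\<epsilon>\<close> tends to 0, and the bound on the mean square gives that on the mean.
\<close>

section \<open>Gaussian integration by parts\<close>

text \<open>The true pseudoinverse of G blows up where G loses rank, so its entries admit no growth
  bound. With \<epsilon> > 0 they are bounded by a constant depending on \<epsilon> only, and every
  integrand grows at most quadratically; integrability and boundary terms become elementary. The
  price is a bias in the leading block that vanishes with \<epsilon>.

  The number p - 1 arises as r - k - 1. Put K = (G G^T + \<epsilon> I)^-1 and P = G^T K. The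
  divergence of P as a function of G is at least (r - k - 1) tr K, and integration by parts equates
  its mean with that of tr (G P), which is at most k. Hence E tr K is at most k / (p - 1); and tr K
  dominates the squared norm of P, the factor by which the trailing part of A is amplified.

  A second obstacle is measurability, as the QR factors are arbitrary choices. Only the projection W
  W^T is determined by Y, and a formula for it in the entries of Y gives a measurable version of the
  error.\<close>

lemma linear_times_std_normal_density_tendsto_0:
  assumes "\<And>y. \<bar>g y\<bar> \<le> C * (1 + \<bar>y\<bar>)"
  shows "((\<lambda>y. g y * std_normal_density y) \<longlongrightarrow> 0) at_top"
    and "((\<lambda>y. g y * std_normal_density y) \<longlongrightarrow> 0) at_bot"
proof -
  let ?h = "\<lambda>y::real. C * (1 + \<bar>y\<bar>) * (1 / sqrt (2 * pi) * exp (- y\<^sup>2 / 2))"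
  have b: "norm (g y * std_normal_density y) \<le> ?h y" for y
    using mult_right_mono[OF assms[of y], of "1 / sqrt (2 * pi) * exp (- y\<^sup>2 / 2)"]
    by (simp add: std_normal_density_def abs_mult)
  have 1: "(?h \<longlongrightarrow> 0) at_top" "(?h \<longlongrightarrow> 0) at_bot"
    by real_asymp+
  show "((\<lambda>y. g y * std_normal_density y) \<longlongrightarrow> 0) at_top"
    by (rule Lim_null_comparison[OF always_eventually[OF allI[OF b]] 1(1)])
  show "((\<lambda>y. g y * std_normal_density y) \<longlongrightarrow> 0) at_bot"
    by (rule Lim_null_comparison[OF always_eventually[OF allI[OF b]] 1(2)])
qed

lemma DERIV_std_normal_density:
  "(std_normal_density has_field_derivative - y * std_normal_density y) (at y)"
  unfolding std_normal_density_def by (auto intro!: derivative_eq_intros simp: field_simps)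

lemma integrable_std_normal_quadratic_bound:
  fixes f :: "real \<Rightarrow> real"
  assumes "f \<in> borel_measurable borel" "\<And>y. \<bar>f y\<bar> \<le> D * (1 + \<bar>y\<bar>)\<^sup>2"
  shows "integrable std_normal_distribution f"
proof (rule Bochner_Integration.integrable_bound)
  \<comment> \<open>The constant is written as \<open>2 * y ^ 0\<close> so that both summands are
    moments of the normal law.\<close>
  show "integrable std_normal_distribution (\<lambda>y. \<bar>D\<bar> * (2 * y ^ 0 + 2 * y ^ 2))"
    by (intro integrable_mult_right Bochner_Integration.integrable_add integrable_std_normal_distribution_moment)
  have "(1 + \<bar>y\<bar>)\<^sup>2 \<le> 2 + 2 * y\<^sup>2" for y :: real
    using sum_squares_bound[of 1 "\<bar>y\<bar>"] by (simp add: power2_sum)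
  then have "\<bar>f y\<bar> \<le> \<bar>D\<bar> * (2 + 2 * y\<^sup>2)" for y
    using assms(2)[of y] mult_mono[of D "\<bar>D\<bar>" "(1 + \<bar>y\<bar>)\<^sup>2" "2 + 2 * y\<^sup>2"] by (meson abs_ge_self abs_ge_zero order_trans zero_le_power2)
  then show "AE y in std_normal_distribution. norm (f y) \<le> norm (\<bar>D\<bar> * (2 * y ^ 0 + 2 * y ^ 2))"
    by (simp add: abs_mult)
qed (use assms in simp)

text \<open>The density satisfies \<phi>' = -y \<phi>, so \<phi> (g' - y g) is the derivative of g
  \<phi>, which tends to 0 at both ends of the line. Linear growth of \<open>g\<close> and quadratic
  growth of \<open>g'\<close> cover every function to which the identity is applied.\<close>

lemma std_normal_integral_by_parts:
  fixes g g' :: "real \<Rightarrow> real"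
  assumes g: "\<And>y. (g has_field_derivative g' y) (at y)"
    and g'cont: "\<And>y. isCont g' y"
    and gb: "\<And>y. \<bar>g y\<bar> \<le> C * (1 + \<bar>y\<bar>)"
    and g'b: "\<And>y. \<bar>g' y\<bar> \<le> D * (1 + \<bar>y\<bar>)\<^sup>2"
  shows "(\<integral>y. y * g y \<partial>std_normal_distribution) = (\<integral>y. g' y \<partial>std_normal_distribution)"
proof -
  let ?\<phi> = std_normal_density
  have gcont: "isCont g y" for y using g DERIV_isCont by blast
  have [measurable]: "g \<in> borel_measurable borel" "g' \<in> borel_measurable borel"
    using gcont g'cont by (auto intro!: borel_measurable_continuous_onI simp: continuous_on_eq_continuous_at)
  have i1: "integrable std_normal_distribution g'"
    by (rule integrable_std_normal_quadratic_bound[OF _ g'b]) simp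
  have C0: "0 \<le> C" using gb[of 0] by simp
  have i2: "integrable std_normal_distribution (\<lambda>y. y * g y)"
  proof (rule integrable_std_normal_quadratic_bound)
    fix y :: real
    have "\<bar>y * g y\<bar> \<le> (1 + \<bar>y\<bar>) * (C * (1 + \<bar>y\<bar>))"
      unfolding abs_mult using gb[of y] by (intro mult_mono) auto
    then show "\<bar>y * g y\<bar> \<le> C * (1 + \<bar>y\<bar>)\<^sup>2" by (simp add: power2_eq_square algebra_simps)
  qed simp
  let ?F = "\<lambda>y. g y * ?\<phi> y" and ?f = "\<lambda>y. ?\<phi> y * (g' y - y * g y)"
  have i: "integrable lborel ?f"
    using Bochner_Integration.integrable_diff[OF i1 i2] by (subst (asm) integrable_real_density) auto
  have F: "(?F has_field_derivative ?f y) (at y)" for y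
    by (auto intro!: derivative_eq_intros g DERIV_std_normal_density simp: algebra_simps)
  have "(LBINT y=-\<infinity>..\<infinity>. ?f y) = 0 - 0"
  proof (rule interval_integral_FTC_integrable)
    show "(?F has_vector_derivative ?f y) (at y)" for y
      using F[of y] by (simp add: has_real_derivative_iff_has_vector_derivative)
    show "isCont ?f y" for y
      using gcont g'cont by (intro continuous_intros DERIV_isCont[OF DERIV_std_normal_density]) auto
    show "set_integrable lborel (einterval (- \<infinity>) \<infinity>) ?f"
      using i by (simp add: set_integrable_def)
    show "((?F \<circ> real_of_ereal) \<longlongrightarrow> 0) (at_right (- \<infinity>))"
      using linear_times_std_normal_density_tendsto_0(2)[OF gb] by (simp add: ereal_tendsto_simps)
    show "((?F \<circ> real_of_ereal) \<longlongrightarrow> 0) (at_left \<infinity>)"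
      using linear_times_std_normal_density_tendsto_0(1)[OF gb] by (simp add: ereal_tendsto_simps)
  qed simp
  then have "(\<integral>y. ?f y \<partial>lborel) = 0"
    by (simp add: interval_lebesgue_integral_def set_lebesgue_integral_def)
  then have "(\<integral>y. g' y - y * g y \<partial>std_normal_distribution) = 0"
    by (subst integral_real_density) auto
  then show ?thesis using i1 i2 by simp
qed

section \<open>Gaussian measures on finite products\<close>

text \<open>The summand 1 lets a single quantity absorb constants as well as linear terms, so all
  growth bounds are multiples of it or of its square.\<close>

definition coord_norm :: "'i set \<Rightarrow> ('i \<Rightarrow> real) \<Rightarrow> real" where
  "coord_norm I w = 1 + (\<Sum>i\<in>I. \<bar>w i\<bar>)"

lemma coord_norm_ge_1: "1 \<le> coord_norm I w"
  by (simp add: coord_norm_def sum_nonneg)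

abbreviation gaussian_product :: "'i set \<Rightarrow> ('i \<Rightarrow> real) measure" where
  "gaussian_product I \<equiv> Pi\<^sub>M I (\<lambda>_. std_normal_distribution)"

lemma prob_space_gaussian_product: "prob_space (gaussian_product I)"
  by (intro prob_space_PiM prob_space_normal_density) simp

lemma integrable_gaussian_product_component_square:
  assumes "finite I" "i \<in> I"
  shows "integrable (gaussian_product I) (\<lambda>w. (w i)\<^sup>2)"
proof -
  have d: "distr (gaussian_product I) std_normal_distribution (\<lambda>w. w i) = std_normal_distribution"
    using assms by (intro distr_PiM_component prob_space_normal_density) auto
  have "integrable (distr (gaussian_product I) std_normal_distribution (\<lambda>w. w i)) (\<lambda>y. y\<^sup>2)"
    unfolding d by (rule integrable_std_normal_distribution_moment)
  then show ?thesis
    using assms by (subst (asm) integrable_distr_eq) auto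
qed

text \<open>Cauchy-Schwarz bounds the square of \<open>coord_norm\<close> by a multiple of 1 plus
  the sum of the squared coordinates, and these have finite mean.\<close>

lemma integrable_gaussian_product_quadratic_bound:
  fixes f :: "('i \<Rightarrow> real) \<Rightarrow> real"
  assumes I: "finite I" and f: "f \<in> borel_measurable (gaussian_product I)"
    and b: "\<And>w. \<bar>f w\<bar> \<le> D * (coord_norm I w)\<^sup>2"
  shows "integrable (gaussian_product I) f"
proof (rule Bochner_Integration.integrable_bound[OF _ f])
  interpret prob_space "gaussian_product I" by (rule prob_space_gaussian_product)
  let ?h = "\<lambda>w. \<bar>D\<bar> * (real (card I + 1) * (1 + (\<Sum>i\<in>I. (w i)\<^sup>2)))"
  show "integrable (gaussian_product I) ?h"
    using I by (intro integrable_mult_right Bochner_Integration.integrable_add Bochner_Integration.integrable_sum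
      integrable_gaussian_product_component_square) auto
  have "(coord_norm I w)\<^sup>2 \<le> real (card I + 1) * (1 + (\<Sum>i\<in>I. (w i)\<^sup>2))" for w :: "'i \<Rightarrow> real"
  proof -
    have *: "(\<Sum>i\<in>I. \<bar>w i\<bar>)\<^sup>2 \<le> real (card I) * (\<Sum>i\<in>I. (w i)\<^sup>2)"
      using Cauchy_Schwarz_ineq_sum[of "\<lambda>_. 1" "\<lambda>i. \<bar>w i\<bar>" I] by simp
    have "2 * (\<Sum>i\<in>I. \<bar>w i\<bar>) = (\<Sum>i\<in>I. 2 * 1 * \<bar>w i\<bar>)" by (simp add: sum_distrib_left)
    also have "\<dots> \<le> (\<Sum>i\<in>I. 1 + (w i)\<^sup>2)"
      using sum_squares_bound[of 1 "\<bar>w i\<bar>" for i] by (intro sum_mono) auto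
    also have "\<dots> = real (card I) + (\<Sum>i\<in>I. (w i)\<^sup>2)" by (simp add: sum.distrib)
    finally show ?thesis using * unfolding coord_norm_def power2_sum by (simp add: algebra_simps)
  qed
  then have "\<bar>f w\<bar> \<le> ?h w" for w
    using b[of w] mult_mono[of D "\<bar>D\<bar>" "(coord_norm I w)\<^sup>2" "real (card I + 1) * (1 + (\<Sum>i\<in>I. (w i)\<^sup>2))"]
    by (meson abs_ge_self abs_ge_zero order_trans zero_le_power2)
  then show "AE w in gaussian_product I. norm (f w) \<le> norm (?h w)"
    by (intro always_eventually allI) (metis abs_ge_self order_trans real_norm_def)
qed

text \<open>Fubini isolates the coordinate \<open>e\<close>; with the others frozen, the claim is
  the one-dimensional identity. The growth bounds make both sides integrable, as the iterated
  integrals require.\<close>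

lemma gaussian_product_integral_by_parts:
  fixes f f' :: "('i \<Rightarrow> real) \<Rightarrow> real"
  assumes I: "finite I" "e \<in> I"
    and [measurable]: "f \<in> borel_measurable (gaussian_product I)" "f' \<in> borel_measurable (gaussian_product I)"
    and deriv: "\<And>w y. ((\<lambda>y. f (w(e := y))) has_field_derivative f' (w(e := y))) (at y)"
    and cont: "\<And>w y. isCont (\<lambda>y. f' (w(e := y))) y"
    and fb: "\<And>w. \<bar>f w\<bar> \<le> C * coord_norm I w"
    and f'b: "\<And>w. \<bar>f' w\<bar> \<le> D * (coord_norm I w)\<^sup>2"
  shows "(\<integral>w. w e * f w \<partial>gaussian_product I) = (\<integral>w. f' w \<partial>gaussian_product I)"
proof -
  interpret product_sigma_finite "\<lambda>_::'i. std_normal_distribution"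
    unfolding product_sigma_finite_def
    using prob_space_normal_density[of 1 0] prob_space_imp_sigma_finite by auto
  define J where "J = I - {e}"
  have J: "finite J" "e \<notin> J" "insert e J = I" using I by (auto simp: J_def)
  have N1: "1 \<le> coord_norm I w" for w by (rule coord_norm_ge_1)
  have C0: "0 \<le> C" using fb[of undefined] N1[of undefined] by (smt (verit) mult_neg_pos)
  have D0: "0 \<le> D" using f'b[of undefined] N1[of undefined]
    by (smt (verit) mult_neg_pos zero_less_power)
  have we: "\<bar>w e\<bar> \<le> coord_norm I w" for w
    using member_le_sum[of e I "\<lambda>i. \<bar>w i\<bar>"] I by (auto simp: coord_norm_def)
  have i1: "integrable (gaussian_product I) (\<lambda>w. w e * f w)"
  proof (rule integrable_gaussian_product_quadratic_bound[OF I(1)])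
    fix w :: "'i \<Rightarrow> real"
    have "\<bar>w e * f w\<bar> \<le> coord_norm I w * (C * coord_norm I w)"
      unfolding abs_mult using we[of w] fb[of w] N1[of w] by (intro mult_mono) auto
    then show "\<bar>w e * f w\<bar> \<le> C * (coord_norm I w)\<^sup>2" by (simp add: power2_eq_square algebra_simps)
  next
    show "(\<lambda>w. w e * f w) \<in> borel_measurable (gaussian_product I)" using I by measurable
  qed
  have i2: "integrable (gaussian_product I) f'"
    by (rule integrable_gaussian_product_quadratic_bound[OF I(1) _ f'b]) simp
  have "(\<integral>y. y * f (w(e := y)) \<partial>std_normal_distribution) = (\<integral>y. f' (w(e := y)) \<partial>std_normal_distribution)" for w
  proof (rule std_normal_integral_by_parts[OF deriv cont])
    fix y
    let ?s = "coord_norm J w"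
    have s1: "1 \<le> ?s" by (rule coord_norm_ge_1)
    have "(\<Sum>i\<in>I. \<bar>(w(e := y)) i\<bar>) = \<bar>y\<bar> + (\<Sum>i\<in>J. \<bar>w i\<bar>)"
      unfolding J(3)[symmetric] using J(1,2) by (subst sum.insert) (auto intro!: sum.cong)
    then have "coord_norm I (w(e := y)) = \<bar>y\<bar> + ?s" by (simp add: coord_norm_def)
    also have "\<dots> \<le> ?s * (1 + \<bar>y\<bar>)" using mult_right_mono[OF s1, of "\<bar>y\<bar>"] by (simp add: algebra_simps)
    finally have *: "coord_norm I (w(e := y)) \<le> ?s * (1 + \<bar>y\<bar>)" .
    show "\<bar>f (w(e := y))\<bar> \<le> C * ?s * (1 + \<bar>y\<bar>)"
      using fb[of "w(e:=y)"] mult_left_mono[OF * C0] by (simp add: mult.assoc)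
    have "(coord_norm I (w(e := y)))\<^sup>2 \<le> (?s * (1 + \<bar>y\<bar>))\<^sup>2"
      using * N1[of "w(e:=y)"] by (intro power_mono) auto
    from mult_left_mono[OF this D0]
    show "\<bar>f' (w(e := y))\<bar> \<le> D * ?s\<^sup>2 * (1 + \<bar>y\<bar>)\<^sup>2"
      using f'b[of "w(e:=y)"] by (simp add: mult.assoc power_mult_distrib)
  qed
  then show ?thesis
    using product_integral_insert[OF J(1,2), of "\<lambda>w. w e * f w"] product_integral_insert[OF J(1,2), of f'] i1 i2
    by (simp add: J(3))
qed

section \<open>Measurability of matrix functions\<close>

text \<open>Cramer's rule makes the inverse visibly measurable. A singular matrix is sent to the zero matrix, as \<open>1 / 0 = 0\<close>.\<close>

definition cramer_inverse :: "real mat \<Rightarrow> real mat" where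
  "cramer_inverse S = (1 / det S) \<cdot>\<^sub>m adj_mat S"

lemma cramer_inverse:
  assumes "S \<in> carrier_mat n n" "det S \<noteq> 0"
  shows "cramer_inverse S \<in> carrier_mat n n" "S * cramer_inverse S = 1\<^sub>m n"
proof -
  show "cramer_inverse S \<in> carrier_mat n n"
    using adj_mat(1)[OF assms(1)] by (simp add: cramer_inverse_def)
  have "S * cramer_inverse S = (1 / det S) \<cdot>\<^sub>m (det S \<cdot>\<^sub>m 1\<^sub>m n)"
    using mult_smult_distrib[OF assms(1) adj_mat(1)[OF assms(1)]] adj_mat(2)[OF assms(1)]
    by (simp add: cramer_inverse_def)
  also have "\<dots> = 1\<^sub>m n" using assms(2) by (intro eq_matI) auto
  finally show "S * cramer_inverse S = 1\<^sub>m n" .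
qed

lemma borel_measurable_det:
  fixes F :: "'a \<Rightarrow> real mat"
  assumes "\<And>w. F w \<in> carrier_mat n n"
    and m: "\<And>i j. i < n \<Longrightarrow> j < n \<Longrightarrow> (\<lambda>w. F w $$ (i, j)) \<in> borel_measurable M"
  shows "(\<lambda>w. det (F w)) \<in> borel_measurable M"
proof -
  have "det (F w) = (\<Sum>p\<in>{p. p permutes {0..<n}}. signof p * (\<Prod>i = 0..<n. F w $$ (i, p i)))" for w
    using assms(1)[of w] by (simp add: det_def')
  moreover have "p i < n" if "p permutes {0..<n}" "i < n" for p i
    using permutes_in_image[OF that(1), of i] that(2) by simp
  ultimately show ?thesis
    by (auto intro!: borel_measurable_sum borel_measurable_times borel_measurable_prod m)
qed

lemma borel_measurable_cramer_inverse:
  fixes F :: "'a \<Rightarrow> real mat"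
  assumes F: "\<And>w. F w \<in> carrier_mat n n"
    and m: "\<And>i j. i < n \<Longrightarrow> j < n \<Longrightarrow> (\<lambda>w. F w $$ (i, j)) \<in> borel_measurable M"
    and ij: "i < n" "j < n"
  shows "(\<lambda>w. cramer_inverse (F w) $$ (i, j)) \<in> borel_measurable M"
proof -
  have "cramer_inverse (F w) $$ (i, j) = 1 / det (F w) * ((-1) ^ (j + i) * det (mat_delete (F w) j i))" for w
    using F[of w] ij by (simp add: cramer_inverse_def adj_mat_def cofactor_def)
  moreover have "(\<lambda>w. det (mat_delete (F w) j i)) \<in> borel_measurable M"
  proof (rule borel_measurable_det)
    show "mat_delete (F w) j i \<in> carrier_mat (n - 1) (n - 1)" for w
      using mat_delete_carrier[OF F[of w]] .
    fix a b assume ab: "a < n - 1" "b < n - 1"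
    have "mat_delete (F w) j i $$ (a, b) = F w $$ (if a < j then a else Suc a, if b < i then b else Suc b)" for w
      using F[of w] ab by (simp add: mat_delete_def)
    then show "(\<lambda>w. mat_delete (F w) j i $$ (a, b)) \<in> borel_measurable M"
      using ab by (auto intro!: m)
  qed
  ultimately show ?thesis using borel_measurable_det[OF F m] by simp
qed

lemma borel_measurable_mat_mult:
  fixes F H :: "'a \<Rightarrow> real mat"
  assumes "\<And>w. F w \<in> carrier_mat a b" "\<And>w. H w \<in> carrier_mat b c"
    and "\<And>i j. i < a \<Longrightarrow> j < b \<Longrightarrow> (\<lambda>w. F w $$ (i, j)) \<in> borel_measurable M"
    and "\<And>i j. i < b \<Longrightarrow> j < c \<Longrightarrow> (\<lambda>w. H w $$ (i, j)) \<in> borel_measurable M"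
    and ij: "i < a" "j < c"
  shows "(\<lambda>w. (F w * H w) $$ (i, j)) \<in> borel_measurable M"
proof -
  have "(F w * H w) $$ (i, j) = (\<Sum>l<b. F w $$ (i, l) * H w $$ (l, j))" for w
    using assms(1)[of w] assms(2)[of w] ij by (simp add: scalar_prod_def lessThan_atLeast0)
  then show ?thesis using assms(3,4) ij by (auto intro!: borel_measurable_sum borel_measurable_times)
qed

text \<open>For Y of full column rank, Y (Y^T Y)^-1 Y^T is the orthogonal projection onto its range.
  This expression is the measurable version of the error, free of any choice of QR
  factorization.\<close>

lemma borel_measurable_projection_residual:
  fixes Y :: "'a \<Rightarrow> real mat"
  assumes A: "A \<in> carrier_mat m n" and Y: "\<And>w. Y w \<in> carrier_mat m r"
    and meas: "\<And>i j. i < m \<Longrightarrow> j < r \<Longrightarrow> (\<lambda>w. Y w $$ (i, j)) \<in> borel_measurable M"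
  shows "(\<lambda>w. frobenius_norm (A - Y w * cramer_inverse (transpose_mat (Y w) * Y w) * transpose_mat (Y w) * A)) \<in> borel_measurable M"
proof -
  let ?S = "\<lambda>w. transpose_mat (Y w) * Y w"
  have Yt: "transpose_mat (Y w) \<in> carrier_mat r m" for w using Y[of w] by simp
  have S: "?S w \<in> carrier_mat r r" for w using Y[of w] by simp
  have K: "cramer_inverse (?S w) \<in> carrier_mat r r" for w
    using adj_mat(1)[OF S[of w]] by (simp add: cramer_inverse_def)
  have mYt: "(\<lambda>w. transpose_mat (Y w) $$ (i, j)) \<in> borel_measurable M" if "i < r" "j < m" for i j
  proof -
    have "transpose_mat (Y w) $$ (i, j) = Y w $$ (j, i)" for w
      using that carrier_matD[OF Y[of w]] by simp
    then show ?thesis using meas[OF that(2,1)] by (simp only:)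
  qed
  have mS: "(\<lambda>w. ?S w $$ (i, j)) \<in> borel_measurable M" if "i < r" "j < r" for i j
    by (rule borel_measurable_mat_mult[OF Yt Y mYt meas that])
  have mK: "(\<lambda>w. cramer_inverse (?S w) $$ (i, j)) \<in> borel_measurable M" if "i < r" "j < r" for i j
    by (rule borel_measurable_cramer_inverse[OF S mS that])
  have YK: "Y w * cramer_inverse (?S w) \<in> carrier_mat m r" for w using Y K by (rule mult_carrier_mat)
  have mYK: "(\<lambda>w. (Y w * cramer_inverse (?S w)) $$ (i, j)) \<in> borel_measurable M" if "i < m" "j < r" for i j
    by (rule borel_measurable_mat_mult[OF Y K meas mK that])
  have P: "Y w * cramer_inverse (?S w) * transpose_mat (Y w) \<in> carrier_mat m m" for w using YK Yt by (rule mult_carrier_mat)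
  have mP: "(\<lambda>w. (Y w * cramer_inverse (?S w) * transpose_mat (Y w)) $$ (i, j)) \<in> borel_measurable M" if "i < m" "j < m" for i j
    by (rule borel_measurable_mat_mult[OF YK Yt mYK mYt that])
  have PA: "Y w * cramer_inverse (?S w) * transpose_mat (Y w) * A \<in> carrier_mat m n" for w using P A by (rule mult_carrier_mat)
  have mPA: "(\<lambda>w. (Y w * cramer_inverse (?S w) * transpose_mat (Y w) * A) $$ (i, j)) \<in> borel_measurable M" if "i < m" "j < n" for i j
    by (rule borel_measurable_mat_mult[OF P A mP _ that]) simp_all
  have "frobenius_norm (A - Y w * cramer_inverse (?S w) * transpose_mat (Y w) * A)
    = sqrt (\<Sum>i<m. \<Sum>j<n. (A $$ (i, j) - (Y w * cramer_inverse (?S w) * transpose_mat (Y w) * A) $$ (i, j))\<^sup>2)" for w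
    using carrier_matD[OF A] carrier_matD[OF PA[of w]] unfolding frobenius_norm_def
    by (intro arg_cong[of _ _ sqrt] sum.cong) (auto simp del: index_mult_mat(1))
  then show ?thesis
    by (simp only:) (intro measurable_compose[OF _ borel_measurable_sqrt] borel_measurable_sum borel_measurable_power
      borel_measurable_diff borel_measurable_const mPA, auto)
qed

section \<open>The regularised pseudoinverse\<close>

lemma abs_sum_mult_le:
  fixes x y :: "'a \<Rightarrow> real" and X Y :: real
  assumes "\<And>i. i \<in> S \<Longrightarrow> \<bar>x i\<bar> \<le> X" "\<And>i. i \<in> S \<Longrightarrow> \<bar>y i\<bar> \<le> Y" "0 \<le> X"
  shows "\<bar>\<Sum>i\<in>S. x i * y i\<bar> \<le> card S * (X * Y)"
proof -
  have "\<bar>\<Sum>i\<in>S. x i * y i\<bar> \<le> (\<Sum>i\<in>S. \<bar>x i * y i\<bar>)" by (rule sum_abs)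
  also have "\<dots> \<le> (\<Sum>i\<in>S. X * Y)" unfolding abs_mult using assms by (intro sum_mono mult_mono) auto
  finally show ?thesis by simp
qed

locale ridge =
  fixes k r :: nat and \<epsilon> :: real
  assumes eps_pos: "0 < \<epsilon>"
begin

text \<open>The matrix G G^T + \<epsilon> I. Matrices are encoded as functions of two indices
  because derivatives and integrals are taken entry by entry; only row indices below
  \<open>k\<close> and column indices below \<open>r\<close> are meaningful.\<close>

definition gram :: "(nat \<Rightarrow> nat \<Rightarrow> real) \<Rightarrow> nat \<Rightarrow> nat \<Rightarrow> real" where
  "gram G a b = (\<Sum>j<r. G a j * G b j) + (if a = b then \<epsilon> else 0)"

definition ginv :: "(nat \<Rightarrow> nat \<Rightarrow> real) \<Rightarrow> nat \<Rightarrow> nat \<Rightarrow> real" where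
  "ginv G a b = cramer_inverse (mat k k (\<lambda>(a, b). gram G a b)) $$ (a, b)"

definition pinv :: "(nat \<Rightarrow> nat \<Rightarrow> real) \<Rightarrow> nat \<Rightarrow> nat \<Rightarrow> real" where
  "pinv G j c = (\<Sum>a<k. G a j * ginv G a c)"

definition gtrace :: "(nat \<Rightarrow> nat \<Rightarrow> real) \<Rightarrow> real" where
  "gtrace G = (\<Sum>a<k. ginv G a a)"

lemma gram_sym: "gram G a b = gram G b a"
  by (simp add: gram_def mult.commute)

text \<open>The quadratic form at v is |G^T v|^2 + \<epsilon> |v|^2, so a kernel vector is
  zero.\<close>

lemma det_gram_nonzero: "det (mat k k (\<lambda>(a, b). gram G a b)) \<noteq> 0"
proof
  let ?S = "mat k k (\<lambda>(a, b). gram G a b)"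
  assume "det ?S = 0"
  then obtain v where v: "v \<in> carrier_vec k" "v \<noteq> 0\<^sub>v k" "?S *\<^sub>v v = 0\<^sub>v k"
    using det_0_iff_vec_prod_zero[of ?S k] by auto
  have "(\<Sum>b<k. gram G a b * v $ b) = 0" if "a < k" for a
    using arg_cong[OF v(3), of "\<lambda>x. x $ a"] that v(1)
    by (simp add: scalar_prod_def lessThan_atLeast0)
  then have "0 = (\<Sum>a<k. v $ a * (\<Sum>b<k. gram G a b * v $ b))" by simp
  also have "\<dots> = (\<Sum>a<k. \<Sum>b<k. \<Sum>j<r. (v $ a * G a j) * (v $ b * G b j)) + (\<Sum>a<k. \<epsilon> * (v $ a)\<^sup>2)"
  proof -
    have "v $ a * (\<Sum>b<k. gram G a b * v $ b) = (\<Sum>b<k. \<Sum>j<r. (v $ a * G a j) * (v $ b * G b j)) + \<epsilon> * (v $ a)\<^sup>2"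
      if "a < k" for a
    proof -
      have "v $ a * (gram G a b * v $ b) = (\<Sum>j<r. (v $ a * G a j) * (v $ b * G b j)) + (if b = a then \<epsilon> * (v $ a)\<^sup>2 else 0)" for b
        by (auto simp: gram_def algebra_simps sum_distrib_left power2_eq_square)
      then show ?thesis using that by (simp add: sum_distrib_left sum.distrib)
    qed
    then show ?thesis by (simp add: sum.distrib)
  qed
  also have "(\<Sum>a<k. \<Sum>b<k. \<Sum>j<r. (v $ a * G a j) * (v $ b * G b j)) = (\<Sum>j<r. (\<Sum>a<k. v $ a * G a j)\<^sup>2)"
    by (simp add: power2_eq_square sum_product sum.swap[of _ _ "{..<r}"])
  finally have "(\<Sum>a<k. \<epsilon> * (v $ a)\<^sup>2) \<le> 0"
    using sum_nonneg[of "{..<r}" "\<lambda>j. (\<Sum>a<k. v $ a * G a j)\<^sup>2"] by simp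
  then have "(\<Sum>a<k. \<epsilon> * (v $ a)\<^sup>2) = 0"
    using sum_nonneg[of "{..<k}" "\<lambda>a. \<epsilon> * (v $ a)\<^sup>2"] eps_pos by simp
  then have "\<forall>a<k. v $ a = 0"
    using sum_nonneg_eq_0_iff[of "{..<k}" "\<lambda>a. \<epsilon> * (v $ a)\<^sup>2"] eps_pos by simp
  then have "v = 0\<^sub>v k" using v(1) by (intro eq_vecI) auto
  then show False using v(2) by simp
qed

lemma gram_ginv:
  assumes "a < k" "c < k"
  shows "(\<Sum>b<k. gram G a b * ginv G b c) = (if a = c then 1 else 0)"
proof -
  let ?S = "mat k k (\<lambda>(a, b). gram G a b)"
  have c: "?S \<in> carrier_mat k k" by simp
  note inv = cramer_inverse[OF c det_gram_nonzero]
  have "(\<Sum>b<k. gram G a b * ginv G b c) = (?S * cramer_inverse ?S) $$ (a, c)"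
    using assms inv(1) by (simp add: scalar_prod_def lessThan_atLeast0 ginv_def)
  then show ?thesis unfolding inv(2) using assms by simp
qed

text \<open>This is G G^T K = I - \<epsilon> K for K = \<open>ginv G\<close>: the regularised
  pseudoinverse misses being a right inverse of G by \<epsilon> K, which is the bias in the final
  error.\<close>

lemma pinv_ginv:
  assumes "a < k" "c < k"
  shows "(\<Sum>j<r. G a j * pinv G j c) = (if a = c then 1 else 0) - \<epsilon> * ginv G a c"
proof -
  have "gram G a b * ginv G b c = (\<Sum>j<r. G a j * (G b j * ginv G b c)) + (if b = a then \<epsilon> * ginv G a c else 0)" for b
    by (auto simp: gram_def distrib_right sum_distrib_right mult.assoc)
  then have "(\<Sum>b<k. gram G a b * ginv G b c) = (\<Sum>b<k. (\<Sum>j<r. G a j * (G b j * ginv G b c)) + (if b = a then \<epsilon> * ginv G a c else 0))"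
    by (simp only:)
  also have "\<dots> = (\<Sum>b<k. \<Sum>j<r. G a j * (G b j * ginv G b c)) + \<epsilon> * ginv G a c"
    using assms by (simp add: sum.distrib)
  also have "(\<Sum>b<k. \<Sum>j<r. G a j * (G b j * ginv G b c)) = (\<Sum>j<r. G a j * pinv G j c)"
    by (subst sum.swap) (simp add: pinv_def sum_distrib_left)
  finally show ?thesis unfolding gram_ginv[OF assms] by simp
qed

text \<open>Multiply G P = I - \<epsilon> K by K^T from the left, where K is \<open>ginv G\<close>
  and P is \<open>pinv G\<close>. The left-hand side is symmetric in \<open>c\<close> and
  \<open>d\<close>, which yields the symmetry of K; the case c = d yields bounds that do not depend
  on G.\<close>

lemma pinv_pinv:
  assumes "c < k" "d < k"
  shows "(\<Sum>j<r. pinv G j c * pinv G j d) + \<epsilon> * (\<Sum>a<k. ginv G a c * ginv G a d) = ginv G d c"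
proof -
  have "(\<Sum>j<r. pinv G j c * pinv G j d) = (\<Sum>j<r. \<Sum>a<k. ginv G a c * (G a j * pinv G j d))"
    by (simp add: pinv_def[of G _ c] sum_distrib_left sum_distrib_right mult_ac)
  also have "\<dots> = (\<Sum>a<k. ginv G a c * (\<Sum>j<r. G a j * pinv G j d))"
    by (subst sum.swap) (simp add: sum_distrib_left)
  also have "\<dots> = (\<Sum>a<k. (if a = d then ginv G a c else 0) - \<epsilon> * (ginv G a c * ginv G a d))"
    using assms by (intro sum.cong) (auto simp: pinv_ginv algebra_simps)
  also have "\<dots> = ginv G d c - \<epsilon> * (\<Sum>a<k. ginv G a c * ginv G a d)"
    using assms by (simp add: sum_subtractf sum_distrib_left)
  finally show ?thesis by simp
qed

lemma ginv_sym: "c < k \<Longrightarrow> d < k \<Longrightarrow> ginv G c d = ginv G d c"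
  using pinv_pinv[of c d G] pinv_pinv[of d c G] by (simp add: mult.commute)

lemma ginv_diag:
  assumes "c < k"
  shows "(\<Sum>j<r. (pinv G j c)\<^sup>2) + \<epsilon> * (\<Sum>a<k. (ginv G a c)\<^sup>2) = ginv G c c"
  using pinv_pinv[OF assms assms] by (simp add: power2_eq_square)

lemma ginv_diag_nonneg: "c < k \<Longrightarrow> 0 \<le> ginv G c c"
  using ginv_diag[of c G] eps_pos by (smt (verit) mult_nonneg_nonneg sum_nonneg zero_le_power2)

lemma gtrace_nonneg: "0 \<le> gtrace G"
  unfolding gtrace_def by (intro sum_nonneg ginv_diag_nonneg) auto

lemma eps_ginv_square_le: "a < k \<Longrightarrow> c < k \<Longrightarrow> \<epsilon> * (ginv G a c)\<^sup>2 \<le> ginv G c c"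
proof -
  assume a: "a < k" "c < k"
  have "(ginv G a c)\<^sup>2 \<le> (\<Sum>a<k. (ginv G a c)\<^sup>2)"
    using a by (intro member_le_sum) auto
  then have "\<epsilon> * (ginv G a c)\<^sup>2 \<le> \<epsilon> * (\<Sum>a<k. (ginv G a c)\<^sup>2)"
    using eps_pos by (intro mult_left_mono) auto
  then show ?thesis using ginv_diag[OF a(2), of G] sum_nonneg[of "{..<r}" "\<lambda>j. (pinv G j c)\<^sup>2"] by simp
qed

text \<open>A diagonal entry x is nonnegative and satisfies \<epsilon> x^2 \<le> x.\<close>

lemma ginv_diag_le: assumes "c < k" shows "ginv G c c \<le> 1 / \<epsilon>"
proof (cases "ginv G c c = 0")
  case False
  then have "0 < ginv G c c" using ginv_diag_nonneg[OF assms, of G] by simp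
  then show ?thesis using eps_ginv_square_le[OF assms assms, of G] eps_pos
    by (simp add: power2_eq_square field_simps)
qed (use eps_pos in simp)

lemma ginv_bound: assumes "a < k" "c < k" shows "\<bar>ginv G a c\<bar> \<le> 1 / \<epsilon>"
proof -
  have "\<epsilon> * (ginv G a c)\<^sup>2 \<le> 1 / \<epsilon>" using eps_ginv_square_le[OF assms, of G] ginv_diag_le[OF assms(2), of G] by simp
  then have "\<bar>ginv G a c\<bar>\<^sup>2 \<le> (1 / \<epsilon>)\<^sup>2" using eps_pos by (simp add: power2_eq_square field_simps)
  then show ?thesis by (rule power2_le_imp_le) (use eps_pos in auto)
qed

text \<open>The squares of a column sum to at most 1 / \<epsilon>. The coarser 1 + 1 / \<epsilon>
  avoids a square root, is at least 1 and also dominates the entries of \<open>ginv\<close>, so it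
  can serve as the common constant \<open>bnd\<close>.\<close>

lemma pinv_bound: assumes "j < r" "c < k" shows "\<bar>pinv G j c\<bar> \<le> 1 + 1 / \<epsilon>"
proof -
  have "(pinv G j c)\<^sup>2 \<le> (\<Sum>j<r. (pinv G j c)\<^sup>2)"
    using assms by (intro member_le_sum) auto
  also have "\<dots> \<le> 1 / \<epsilon>" using ginv_diag[OF assms(2), of G] ginv_diag_le[OF assms(2), of G] eps_pos
    by (smt (verit) mult_nonneg_nonneg sum_nonneg zero_le_power2)
  also have "\<dots> \<le> (1 + 1 / \<epsilon>)\<^sup>2" using eps_pos self_le_power[of "1 + 1 / \<epsilon>" 2] by simp
  finally have "\<bar>pinv G j c\<bar>\<^sup>2 \<le> (1 + 1 / \<epsilon>)\<^sup>2" by simp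
  then show ?thesis by (rule power2_le_imp_le) (use eps_pos in auto)
qed

text \<open>The trace splits into the two quantities that govern the error: the squared norm of
  \<open>pinv\<close>, which amplifies the trailing rows, and \<epsilon> times the squared norm of
  \<open>ginv\<close>, which measures the bias.\<close>

lemma sum_pinv_square:
  "(\<Sum>c<k. \<Sum>j<r. (pinv G j c)\<^sup>2) + \<epsilon> * (\<Sum>c<k. \<Sum>a<k. (ginv G a c)\<^sup>2) = gtrace G"
proof -
  have "(\<Sum>c<k. (\<Sum>j<r. (pinv G j c)\<^sup>2) + \<epsilon> * (\<Sum>a<k. (ginv G a c)\<^sup>2)) = gtrace G"
    unfolding gtrace_def by (intro sum.cong ginv_diag) auto
  then show ?thesis by (simp add: sum.distrib sum_distrib_left)
qed

lemma sum_pinv_square_le: "(\<Sum>c<k. \<Sum>j<r. (pinv G j c)\<^sup>2) \<le> gtrace G"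
  using sum_pinv_square[of G] eps_pos
  by (smt (verit) mult_nonneg_nonneg sum_nonneg zero_le_power2)

lemma sum_ginv_square_le: "\<epsilon> * (\<Sum>c<k. \<Sum>a<k. (ginv G a c)\<^sup>2) \<le> gtrace G"
  using sum_pinv_square[of G] by (smt (verit) sum_nonneg zero_le_power2)

lemma sum_pinv: "(\<Sum>c<k. \<Sum>j<r. G c j * pinv G j c) = k - \<epsilon> * gtrace G"
proof -
  have "(\<Sum>c<k. \<Sum>j<r. G c j * pinv G j c) = (\<Sum>c<k. 1 - \<epsilon> * ginv G c c)"
    by (intro sum.cong) (auto simp: pinv_ginv)
  then show ?thesis by (simp add: sum_subtractf gtrace_def sum_distrib_left)
qed

text \<open>The resolvent identity; it yields differentiability of the inverse without differentiating a determinant.\<close>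

lemma ginv_diff:
  assumes "a < k" "c < k"
  shows "ginv H a c - ginv G a c = (\<Sum>b<k. \<Sum>d<k. ginv H a b * (gram G b d - gram H b d) * ginv G d c)"
proof -
  have "(\<Sum>b<k. \<Sum>d<k. ginv H a b * gram G b d * ginv G d c) = (\<Sum>b<k. ginv H a b * (\<Sum>d<k. gram G b d * ginv G d c))"
    by (simp add: sum_distrib_left mult.assoc)
  also have "\<dots> = (\<Sum>b<k. if b = c then ginv H a b else 0)"
    using assms by (intro sum.cong) (auto simp: gram_ginv)
  also have "\<dots> = ginv H a c" using assms by simp
  finally have 1: "(\<Sum>b<k. \<Sum>d<k. ginv H a b * gram G b d * ginv G d c) = ginv H a c" .
  have "(\<Sum>b<k. \<Sum>d<k. ginv H a b * gram H b d * ginv G d c) = (\<Sum>d<k. (\<Sum>b<k. gram H d b * ginv H b a) * ginv G d c)"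
    using assms by (subst sum.swap)
      (auto simp: sum_distrib_left sum_distrib_right gram_sym ginv_sym algebra_simps intro!: sum.cong)
  also have "\<dots> = (\<Sum>d<k. if d = a then ginv G d c else 0)"
    using assms by (intro sum.cong) (auto simp: gram_ginv)
  also have "\<dots> = ginv G a c" using assms by simp
  finally show ?thesis using 1 by (simp add: right_diff_distrib left_diff_distrib sum_subtractf)
qed

section \<open>Derivatives of the regularised inverse and pseudoinverse\<close>

lemma DERIV_gram:
  assumes "\<And>a b. a < k \<Longrightarrow> b < r \<Longrightarrow> ((\<lambda>x. H x a b) has_field_derivative dH a b) (at y)"
    and "a < k" "b < k"
  shows "((\<lambda>x. gram (H x) a b) has_field_derivative (\<Sum>j<r. dH a j * H y b j + H y a j * dH b j)) (at y)"
proof -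
  have "((\<lambda>x. H x a j * H x b j) has_field_derivative dH a j * H y b j + H y a j * dH b j) (at y)" if "j < r" for j
    using assms that by (auto intro!: derivative_eq_intros)
  then have "((\<lambda>x. (\<Sum>j<r. H x a j * H x b j) + (if a = b then \<epsilon> else 0)) has_field_derivative
      (\<Sum>j<r. dH a j * H y b j + H y a j * dH b j) + 0) (at y)"
    by (intro DERIV_add DERIV_sum DERIV_const) auto
  then show ?thesis by (simp add: gram_def)
qed

text \<open>The formula is K' = -K S' K for the inverse K of S = \<open>gram\<close>. The resolvent
  identity expresses the difference quotient of K through that of S, so only a passage to the limit
  remains.\<close>

lemma DERIV_ginv:
  assumes H: "\<And>a b. a < k \<Longrightarrow> b < r \<Longrightarrow> ((\<lambda>x. H x a b) has_field_derivative dH a b) (at y)"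
    and ac: "a < k" "c < k"
  shows "((\<lambda>x. ginv (H x) a c) has_field_derivative
    - (\<Sum>b<k. \<Sum>d<k. ginv (H y) a b * (\<Sum>j<r. dH b j * H y d j + H y b j * dH d j) * ginv (H y) d c)) (at y)"
proof -
  have DG: "((\<lambda>x. gram (H x) a b) has_field_derivative (\<Sum>j<r. dH a j * H y b j + H y a j * dH b j)) (at y)"
    if "a < k" "b < k" for a b using DERIV_gram[of H dH y a b] H that by blast
  \<comment> \<open>Continuity has to come first, since the difference quotient still contains
    \<open>ginv (H x)\<close>. In the resolvent identity this factor is bounded by 1 / \<epsilon>
    uniformly in \<open>x\<close>, while the difference of the Gram matrices tends to 0.\<close>
  have cont: "((\<lambda>x. ginv (H x) a c) \<longlongrightarrow> ginv (H y) a c) (at y)" if "a < k" "c < k" for a c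
  proof -
    have gr: "((\<lambda>x. gram (H y) b d - gram (H x) b d) \<longlongrightarrow> 0) (at y)" if "b < k" "d < k" for b d
      using DERIV_isCont[OF DG[OF that]] tendsto_diff[OF tendsto_const, of "\<lambda>x. gram (H x) b d" "gram (H y) b d" "at y" "gram (H y) b d"]
      by (simp add: isCont_def)
    have "((\<lambda>x. \<Sum>b<k. \<Sum>d<k. ginv (H x) a b * (gram (H y) b d - gram (H x) b d) * ginv (H y) d c) \<longlongrightarrow> 0) (at y)"
    proof (intro tendsto_null_sum tendsto_mult_left_zero)
      fix b d assume bd: "b \<in> {..<k}" "d \<in> {..<k}"
      have "((\<lambda>x. 1 / \<epsilon> * \<bar>gram (H y) b d - gram (H x) b d\<bar>) \<longlongrightarrow> 0) (at y)"
        using gr bd by (intro tendsto_mult_right_zero tendsto_rabs_zero) auto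
      then show "((\<lambda>x. ginv (H x) a b * (gram (H y) b d - gram (H x) b d)) \<longlongrightarrow> 0) (at y)"
      proof (rule Lim_null_comparison[rotated], intro always_eventually allI)
        show "norm (ginv (H x) a b * (gram (H y) b d - gram (H x) b d)) \<le> 1 / \<epsilon> * \<bar>gram (H y) b d - gram (H x) b d\<bar>" for x
          unfolding real_norm_def abs_mult using ginv_bound[of a b "H x"] that bd by (intro mult_right_mono) auto
      qed
    qed
    then have "((\<lambda>x. ginv (H x) a c - ginv (H y) a c) \<longlongrightarrow> 0) (at y)"
      using that by (simp add: ginv_diff)
    then show ?thesis using Lim_null by blast
  qed
  have "((\<lambda>x. \<Sum>b<k. \<Sum>d<k. ginv (H x) a b * (- ((gram (H x) b d - gram (H y) b d) / (x - y))) * ginv (H y) d c) \<longlongrightarrow>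
     (\<Sum>b<k. \<Sum>d<k. ginv (H y) a b * (- (\<Sum>j<r. dH b j * H y d j + H y b j * dH d j)) * ginv (H y) d c)) (at y)"
    using ac DG[unfolded has_field_derivative_iff] by (intro tendsto_sum tendsto_mult tendsto_minus tendsto_const cont) auto
  moreover have "(\<Sum>b<k. \<Sum>d<k. ginv (H x) a b * (- ((gram (H x) b d - gram (H y) b d) / (x - y))) * ginv (H y) d c)
      = (ginv (H x) a c - ginv (H y) a c) / (x - y)" for x
    unfolding ginv_diff[OF ac] sum_divide_distrib by (intro sum.cong refl) (simp only: minus_divide_left minus_diff_eq times_divide_eq_left times_divide_eq_right)
  ultimately have "((\<lambda>x. (ginv (H x) a c - ginv (H y) a c) / (x - y)) \<longlongrightarrow>
     (\<Sum>b<k. \<Sum>d<k. ginv (H y) a b * (- (\<Sum>j<r. dH b j * H y d j + H y b j * dH d j)) * ginv (H y) d c)) (at y)"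
    by (simp only:)
  then show ?thesis
    unfolding has_field_derivative_iff by (simp only: mult_minus_right mult_minus_left sum_negf)
qed

text \<open>An entry of \<Omega> influences a single column g of G. If g moves with velocity v, then
  \<open>gram\<close> changes at the rate v g^T + g v^T, and K g is row \<open>j\<close> of
  \<open>pinv\<close>; the derivative is therefore a sum of two rank one terms.\<close>

lemma DERIV_ginv_column:
  assumes H: "\<And>a b. a < k \<Longrightarrow> b < r \<Longrightarrow> ((\<lambda>x. H x a b) has_field_derivative (if b = j then v a else 0)) (at y)"
    and "j < r" "a < k" "c < k"
  shows "((\<lambda>x. ginv (H x) a c) has_field_derivative
    - ((\<Sum>d<k. ginv (H y) a d * v d) * pinv (H y) j c + pinv (H y) j a * (\<Sum>d<k. ginv (H y) c d * v d))) (at y)"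
proof -
  have "(\<Sum>b<k. \<Sum>d<k. ginv (H y) a b * (\<Sum>i<r. (if i = j then v b else 0) * H y d i + H y b i * (if i = j then v d else 0)) * ginv (H y) d c)
    = (\<Sum>b<k. \<Sum>d<k. ginv (H y) a b * v b * (H y d j * ginv (H y) d c)) +
      (\<Sum>b<k. \<Sum>d<k. H y b j * ginv (H y) a b * (ginv (H y) d c * v d))"
    using assms(2) by (simp add: sum.distrib if_distrib if_distribR sum.delta algebra_simps cong: if_cong)
  also have "\<dots> = (\<Sum>d<k. ginv (H y) a d * v d) * pinv (H y) j c + pinv (H y) j a * (\<Sum>d<k. ginv (H y) c d * v d)"
    using assms(3,4) by (simp add: pinv_def sum_product ginv_sym[of a] ginv_sym[of c])
  finally show ?thesis using DERIV_ginv[of H "\<lambda>a b. if b = j then v a else 0" y, OF H assms(3,4)] by simp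
qed

text \<open>The product rule for P = G^T K: the first term comes from the moving column itself, the
  other two from the two rank one terms in the derivative of K. The sum over \<open>a\<close> in the
  last term is an entry of G^T K G.\<close>

lemma DERIV_pinv_column:
  assumes H: "\<And>a b. a < k \<Longrightarrow> b < r \<Longrightarrow> ((\<lambda>x. H x a b) has_field_derivative (if b = j then v a else 0)) (at y)"
    and "j < r" "b < r" "c < k"
  shows "((\<lambda>x. pinv (H x) b c) has_field_derivative
    (if b = j then \<Sum>d<k. ginv (H y) c d * v d else 0) - (\<Sum>d<k. pinv (H y) b d * v d) * pinv (H y) j c
      - (\<Sum>a<k. H y a b * pinv (H y) j a) * (\<Sum>d<k. ginv (H y) c d * v d)) (at y)"
proof -
  let ?u = "\<lambda>a. \<Sum>d<k. ginv (H y) a d * v d"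
  have D: "((\<lambda>x. pinv (H x) b c) has_field_derivative
     (\<Sum>a<k. (if b = j then v a else 0) * ginv (H y) a c + H y a b * - (?u a * pinv (H y) j c + pinv (H y) j a * ?u c))) (at y)"
    unfolding pinv_def using assms
    by (auto intro!: derivative_eq_intros DERIV_ginv_column[of H j v y, unfolded pinv_def] sum.cong)
  have e1: "(\<Sum>a<k. (if b = j then v a else 0) * ginv (H y) a c) = (if b = j then ?u c else 0)"
    using assms(4) by (auto simp: ginv_sym[of c] mult.commute)
  have e2: "(\<Sum>a<k. H y a b * ?u a) = (\<Sum>d<k. pinv (H y) b d * v d)"
    unfolding pinv_def sum_distrib_left sum_distrib_right by (subst sum.swap) (simp add: mult.assoc)
  have e3: "(\<Sum>a<k. f a + H y a b * - (u a * p + q a * s))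
    = (\<Sum>a<k. f a) - (\<Sum>a<k. H y a b * u a) * p - (\<Sum>a<k. H y a b * q a) * s" for f u q :: "nat \<Rightarrow> real" and p s
    by (simp add: sum.distrib sum_subtractf sum_distrib_left sum_distrib_right algebra_simps sum_negf)
  show ?thesis using D unfolding e3 e1 e2 .
qed

end

lemma (in ridge) borel_measurable_ginv:
  assumes "\<And>a j. a < k \<Longrightarrow> j < r \<Longrightarrow> (\<lambda>w. H w a j) \<in> borel_measurable M" and "a < k" "b < k"
  shows "(\<lambda>w. ginv (H w) a b) \<in> borel_measurable M"
  unfolding ginv_def
  by (rule borel_measurable_cramer_inverse[of _ k])
    (use assms in \<open>auto simp: gram_def intro!: borel_measurable_add borel_measurable_sum borel_measurable_times\<close>)

lemma (in ridge) borel_measurable_pinv: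
  assumes "\<And>a j. a < k \<Longrightarrow> j < r \<Longrightarrow> (\<lambda>w. H w a j) \<in> borel_measurable M" and "j < r" "c < k"
  shows "(\<lambda>w. pinv (H w) j c) \<in> borel_measurable M"
  unfolding pinv_def using assms
  by (auto intro!: borel_measurable_sum borel_measurable_times borel_measurable_ginv)

context ridge
begin

text \<open>The derivative of \<open>pinv G b c\<close> when column \<open>j\<close> of \<open>G\<close> moves in direction \<open>v\<close>.\<close>

definition dpinv :: "(nat \<Rightarrow> nat \<Rightarrow> real) \<Rightarrow> nat \<Rightarrow> (nat \<Rightarrow> real) \<Rightarrow> nat \<Rightarrow> nat \<Rightarrow> real" where
  "dpinv G j v b c = (if b = j then \<Sum>d<k. ginv G c d * v d else 0) - (\<Sum>d<k. pinv G b d * v d) * pinv G j c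
      - (\<Sum>a<k. G a b * pinv G j a) * (\<Sum>d<k. ginv G c d * v d)"

text \<open>Linearity in the direction allows the derivatives in the single entries of \<Omega>,
  weighted by a row of \<open>V\<close>, to be combined into one derivative along a rotated
  axis.\<close>

lemma dpinv_linear:
  "(\<Sum>c\<in>S. \<alpha> c * dpinv G j (v c) b i) = dpinv G j (\<lambda>d. \<Sum>c\<in>S. \<alpha> c * v c d) b i"
proof -
  have lin: "(\<Sum>c\<in>S. \<alpha> c * (\<Sum>d<k. x d * v c d)) = (\<Sum>d<k. x d * (\<Sum>c\<in>S. \<alpha> c * v c d))" for x
    unfolding sum_distrib_left by (subst sum.swap) (simp add: mult_ac)
  have "(\<Sum>c\<in>S. \<alpha> c * (X c - Y c * p - q * X c)) = (\<Sum>c\<in>S. \<alpha> c * X c) - (\<Sum>c\<in>S. \<alpha> c * Y c) * p - q * (\<Sum>c\<in>S. \<alpha> c * X c)"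
    for X Y and p q :: real
    by (simp add: right_diff_distrib sum_subtractf sum_distrib_left sum_distrib_right mult_ac)
  moreover have "(\<Sum>c\<in>S. \<alpha> c * (0 - Y c * p - q * X c)) = 0 - (\<Sum>c\<in>S. \<alpha> c * Y c) * p - q * (\<Sum>c\<in>S. \<alpha> c * X c)"
    for X Y and p q :: real
    by (simp add: right_diff_distrib sum_subtractf sum_distrib_left sum_distrib_right mult_ac sum_negf)
  ultimately show ?thesis unfolding dpinv_def lin[symmetric] by (cases "b = j") (simp_all only: if_True if_False simp_thms)
qed

lemma dpinv_cong: "(\<And>d. d < k \<Longrightarrow> v d = v' d) \<Longrightarrow> dpinv G j v b i = dpinv G j v' b i"
  by (simp add: dpinv_def cong: sum.cong_simp)

text \<open>The right-hand side is the divergence of P. With K = \<open>ginv G\<close> its three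
  terms add up to r tr K - |P|^2 - (k - \<epsilon> tr K) tr K. Here |P|^2 is at most tr K, and
  \<epsilon> (tr K)^2 is nonnegative; this is the origin of the factor r - k - 1.\<close>

lemma sum_dpinv_ge:
  "(real r - real k - 1) * gtrace G \<le> (\<Sum>i<k. \<Sum>j<r. dpinv G j (\<lambda>d. if i = d then 1 else 0) j i)"
proof -
  have *: "dpinv G j (\<lambda>d. if i = d then 1 else 0) j i = ginv G i i - (pinv G j i)\<^sup>2 - (\<Sum>a<k. G a j * pinv G j a) * ginv G i i"
    if "i < k" for i j
    using that by (simp add: dpinv_def if_distrib sum.delta power2_eq_square cong: if_cong)
  have "(\<Sum>j<r. \<Sum>a<k. G a j * pinv G j a) = k - \<epsilon> * gtrace G"
    using sum_pinv[of G] by (subst sum.swap) simp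
  then have "(\<Sum>i<k. \<Sum>j<r. (\<Sum>a<k. G a j * pinv G j a) * ginv G i i) = (k - \<epsilon> * gtrace G) * gtrace G"
    by (simp add: sum_distrib_right[symmetric] sum_distrib_left[symmetric] gtrace_def)
  moreover have "(\<Sum>i<k. \<Sum>j<r. ginv G i i) = r * gtrace G"
    by (simp add: gtrace_def sum_distrib_left)
  moreover have "0 \<le> \<epsilon> * gtrace G * gtrace G"
    using eps_pos gtrace_nonneg[of G] by simp
  ultimately show ?thesis
    using sum_pinv_square_le[of G] by (simp add: * sum_subtractf algebra_simps)
qed

lemma DERIV_pinv:
  assumes "\<And>a b. a < k \<Longrightarrow> b < r \<Longrightarrow> ((\<lambda>x. H x a b) has_field_derivative (if b = j then v a else 0)) (at y)"
    and "j < r" "b < r" "c < k"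
  shows "((\<lambda>x. pinv (H x) b c) has_field_derivative dpinv (H y) j v b c) (at y)"
  unfolding dpinv_def by (rule DERIV_pinv_column) (use assms in auto)

lemma isCont_dpinv:
  assumes H: "\<And>a b. a < k \<Longrightarrow> b < r \<Longrightarrow> ((\<lambda>x. H x a b) has_field_derivative (if b = j then v a else 0)) (at y)"
    and "j < r" "b < r" "c < k"
  shows "isCont (\<lambda>x. dpinv (H x) j v b c) y"
proof -
  have "isCont (\<lambda>x. ginv (H x) a c) y" if "a < k" "c < k" for a c
    using DERIV_isCont[OF DERIV_ginv_column[of H j v y, OF H \<open>j < r\<close> that]] .
  moreover have "isCont (\<lambda>x. pinv (H x) b c) y" if "b < r" "c < k" for b c
    using DERIV_isCont[OF DERIV_pinv[of H j v y, OF H \<open>j < r\<close> that]] .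
  moreover have "isCont (\<lambda>x. H x a b) y" if "a < k" "b < r" for a b
    using DERIV_isCont[OF H[OF that]] .
  ultimately show ?thesis
    unfolding dpinv_def using assms(2-4) by (cases "b = j") (auto intro!: continuous_diff continuous_mult continuous_sum continuous_const)
qed

definition bnd :: real where "bnd = 1 + 1 / \<epsilon>"

lemma bnd: "1 \<le> bnd" "a < k \<Longrightarrow> c < k \<Longrightarrow> \<bar>ginv G a c\<bar> \<le> bnd" "j < r \<Longrightarrow> c < k \<Longrightarrow> \<bar>pinv G j c\<bar> \<le> bnd"
  using eps_pos ginv_bound[of a c G] pinv_bound[of j c G] by (auto simp: bnd_def)

text \<open>Apart from \<open>ginv\<close> and \<open>pinv\<close>, which are bounded,
  \<open>dpinv\<close> contains only one explicit factor from column \<open>b\<close> of G, so the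
  growth is linear. The bounded terms are absorbed by \<open>1 \<le> N\<close>.\<close>

lemma dpinv_bound:
  assumes "j < r" "b < r" "c < k"
    and v: "\<And>d. d < k \<Longrightarrow> \<bar>v d\<bar> \<le> 1" and G: "\<And>a. a < k \<Longrightarrow> \<bar>G a b\<bar> \<le> N" and N: "1 \<le> N"
  shows "\<bar>dpinv G j v b c\<bar> \<le> (k * bnd + k * bnd * bnd + k * bnd * (k * bnd)) * N"
proof -
  have u: "\<bar>\<Sum>d<k. ginv G c d * v d\<bar> \<le> k * bnd"
    using abs_sum_mult_le[of "{..<k}" "\<lambda>d. ginv G c d" bnd v 1] bnd assms by simp
  have z: "\<bar>\<Sum>d<k. pinv G b d * v d\<bar> \<le> k * bnd"
    using abs_sum_mult_le[of "{..<k}" "\<lambda>d. pinv G b d" bnd v 1] bnd assms by simp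
  have h: "\<bar>\<Sum>a<k. G a b * pinv G j a\<bar> \<le> k * (N * bnd)"
    using abs_sum_mult_le[of "{..<k}" "\<lambda>a. G a b" N "\<lambda>a. pinv G j a" bnd] bnd assms by simp
  have kb: "0 \<le> k * bnd" using bnd(1) by simp
  have 1: "\<bar>if b = j then \<Sum>d<k. ginv G c d * v d else 0\<bar> \<le> k * bnd * N"
    using u kb mult_left_mono[OF N kb] by auto
  have "\<bar>(\<Sum>d<k. pinv G b d * v d) * pinv G j c\<bar> \<le> k * bnd * bnd"
    unfolding abs_mult using z bnd assms by (intro mult_mono) auto
  also have "\<dots> \<le> k * bnd * bnd * N" using mult_left_mono[OF N, of "k * bnd * bnd"] kb bnd(1) by simp
  finally have 2: "\<bar>(\<Sum>d<k. pinv G b d * v d) * pinv G j c\<bar> \<le> k * bnd * bnd * N" .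
  have 3: "\<bar>(\<Sum>a<k. G a b * pinv G j a) * (\<Sum>d<k. ginv G c d * v d)\<bar> \<le> k * (N * bnd) * (k * bnd)"
    unfolding abs_mult using h u kb N by (intro mult_mono) auto
  show ?thesis using 1 2 3 unfolding dpinv_def by (simp add: algebra_simps)
qed

end

section \<open>Expectations for a Gaussian matrix\<close>

lemma integral_sum_sum:
  fixes f :: "'a \<Rightarrow> 'b \<Rightarrow> 'c \<Rightarrow> real"
  assumes "\<And>i j. i \<in> S \<Longrightarrow> j \<in> T \<Longrightarrow> integrable M (f i j)"
  shows "(\<integral>w. (\<Sum>i\<in>S. \<Sum>j\<in>T. f i j w) \<partial>M) = (\<Sum>i\<in>S. \<Sum>j\<in>T. \<integral>w. f i j w \<partial>M)"
proof -
  have "(\<integral>w. (\<Sum>i\<in>S. \<Sum>j\<in>T. f i j w) \<partial>M) = (\<Sum>i\<in>S. \<integral>w. (\<Sum>j\<in>T. f i j w) \<partial>M)"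
    using assms by (intro Bochner_Integration.integral_sum Bochner_Integration.integrable_sum) auto
  also have "\<dots> = (\<Sum>i\<in>S. \<Sum>j\<in>T. \<integral>w. f i j w \<partial>M)"
    using assms by (intro sum.cong refl Bochner_Integration.integral_sum) auto
  finally show ?thesis .
qed

locale rotated_ridge = ridge k r \<epsilon> for k r :: nat and \<epsilon> :: real +
  fixes n :: nat and V :: "nat \<Rightarrow> nat \<Rightarrow> real"
  assumes k_le: "k \<le> n"
    and orthonormal: "\<And>l l'. l < n \<Longrightarrow> l' < n \<Longrightarrow> (\<Sum>c<n. V l c * V l' c) = (if l = l' then 1 else 0)"
begin

abbreviation Idx :: "(nat \<times> nat) set" where "Idx \<equiv> {..<n} \<times> {..<r}"

abbreviation \<mu> :: "(nat \<times> nat \<Rightarrow> real) measure" where "\<mu> \<equiv> gaussian_product Idx"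

text \<open>The matrix V^T \<Omega>, as \<open>V l\<close> is the l-th eigenvector. Since
  \<open>ginv\<close> and \<open>pinv\<close> read only row indices below \<open>k\<close>, the same
  function supplies G as their argument and the remaining rows elsewhere.\<close>

definition rot :: "(nat \<times> nat \<Rightarrow> real) \<Rightarrow> nat \<Rightarrow> nat \<Rightarrow> real" where
  "rot w l j = (\<Sum>c<n. V l c * w (c, j))"

lemma V_le: "l < n \<Longrightarrow> c < n \<Longrightarrow> \<bar>V l c\<bar> \<le> 1"
proof -
  assume l: "l < n" "c < n"
  have "V l c * V l c \<le> (\<Sum>c<n. V l c * V l c)"
    using l by (intro member_le_sum) auto
  then have "(V l c)\<^sup>2 \<le> 1" using orthonormal[OF l(1) l(1)] by (simp add: power2_eq_square)
  then show ?thesis by (simp add: abs_square_le_1)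
qed

lemma bnd_le_coord_norm: "bnd \<le> bnd * coord_norm I w"
  using bnd(1) mult_left_mono[OF coord_norm_ge_1[of I w], of bnd] by simp

lemma rot_le: assumes "l < n" "j < r" shows "\<bar>rot w l j\<bar> \<le> coord_norm Idx w"
proof -
  have "\<bar>rot w l j\<bar> \<le> (\<Sum>c<n. \<bar>V l c * w (c, j)\<bar>)" unfolding rot_def by (rule sum_abs)
  also have "\<dots> \<le> (\<Sum>c<n. \<bar>w (c, j)\<bar>)"
    using V_le[OF assms(1)] by (intro sum_mono) (auto simp: abs_mult intro!: mult_left_le_one_le)
  also have "\<dots> \<le> (\<Sum>c<n. \<Sum>j<r. \<bar>w (c, j)\<bar>)"
    using assms by (intro sum_mono member_le_sum) auto
  also have "\<dots> \<le> coord_norm Idx w" by (simp add: coord_norm_def sum.cartesian_product)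
  finally show ?thesis .
qed

lemma borel_measurable_rot: "j < r \<Longrightarrow> (\<lambda>w. rot w l j) \<in> borel_measurable \<mu>"
  unfolding rot_def by (auto intro!: borel_measurable_sum borel_measurable_times)

lemma borel_measurable_rot_ginv: "a < k \<Longrightarrow> c < k \<Longrightarrow> (\<lambda>w. ginv (rot w) a c) \<in> borel_measurable \<mu>"
  by (rule borel_measurable_ginv) (auto intro: borel_measurable_rot)

lemma borel_measurable_rot_pinv: "j < r \<Longrightarrow> c < k \<Longrightarrow> (\<lambda>w. pinv (rot w) j c) \<in> borel_measurable \<mu>"
  by (rule borel_measurable_pinv) (auto intro: borel_measurable_rot)

lemma borel_measurable_rot_dpinv:
  "j < r \<Longrightarrow> b < r \<Longrightarrow> c < k \<Longrightarrow> (\<lambda>w. dpinv (rot w) j v b c) \<in> borel_measurable \<mu>"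
  unfolding dpinv_def
  by (cases "b = j") (auto intro!: borel_measurable_sum borel_measurable_times borel_measurable_diff
      borel_measurable_rot borel_measurable_rot_ginv borel_measurable_rot_pinv)

lemma DERIV_rot:
  assumes "c < n"
  shows "((\<lambda>y. rot (w((c, j) := y)) l b) has_field_derivative (if b = j then V l c else 0)) (at y)"
proof -
  have "((\<lambda>y. \<Sum>i<n. V l i * (w((c, j) := y)) (i, b)) has_field_derivative
      (\<Sum>i<n. if i = c then if b = j then V l c else 0 else 0)) (at y)"
    by (intro DERIV_sum) (auto intro!: derivative_eq_intros)
  then show ?thesis using assms by (simp add: rot_def[abs_def])
qed

text \<open>An entry of \<open>rot w\<close> is a linear combination of independent Gaussian
  coordinates from one column, so the coordinatewise identities add up to a derivative in the
  direction \<open>V l\<close>.\<close>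

lemma rot_integral_by_parts:
  assumes "j < r"
    and [measurable]: "f \<in> borel_measurable \<mu>" "\<And>c. c < n \<Longrightarrow> f' c \<in> borel_measurable \<mu>"
    and "\<And>c w y. c < n \<Longrightarrow> ((\<lambda>y. f (w((c, j) := y))) has_field_derivative f' c (w((c, j) := y))) (at y)"
    and "\<And>c w y. c < n \<Longrightarrow> isCont (\<lambda>y. f' c (w((c, j) := y))) y"
    and fb: "\<And>w. \<bar>f w\<bar> \<le> C * coord_norm Idx w"
    and f'b: "\<And>c w. c < n \<Longrightarrow> \<bar>f' c w\<bar> \<le> D * (coord_norm Idx w)\<^sup>2"
  shows "(\<integral>w. rot w l j * f w \<partial>\<mu>) = (\<integral>w. (\<Sum>c<n. V l c * f' c w) \<partial>\<mu>)"
proof -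
  have i: "integrable \<mu> (\<lambda>w. w (c, j) * f w)" if "c < n" for c
  proof (rule integrable_gaussian_product_quadratic_bound)
    fix w :: "nat \<times> nat \<Rightarrow> real"
    have "\<bar>w (c, j)\<bar> \<le> (\<Sum>i\<in>Idx. \<bar>w i\<bar>)"
      using that assms(1) by (intro member_le_sum) auto
    then have "\<bar>w (c, j)\<bar> * \<bar>f w\<bar> \<le> coord_norm Idx w * (C * coord_norm Idx w)"
      using fb[of w] by (intro mult_mono) (auto simp: coord_norm_def sum_nonneg)
    then show "\<bar>w (c, j) * f w\<bar> \<le> C * (coord_norm Idx w)\<^sup>2"
      by (simp add: abs_mult power2_eq_square mult_ac)
    show "(\<lambda>w. w (c, j) * f w) \<in> borel_measurable \<mu>" using that assms(1,2) by (auto intro!: borel_measurable_times)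
  qed simp
  have i': "integrable \<mu> (f' c)" if "c < n" for c
    by (rule integrable_gaussian_product_quadratic_bound[OF _ _ f'b[OF that]]) (use that in auto)
  have "(\<integral>w. rot w l j * f w \<partial>\<mu>) = (\<integral>w. (\<Sum>c<n. V l c * (w (c, j) * f w)) \<partial>\<mu>)"
    by (simp add: rot_def sum_distrib_right mult.assoc)
  also have "\<dots> = (\<Sum>c<n. V l c * (\<integral>w. w (c, j) * f w \<partial>\<mu>))"
    using i by (subst Bochner_Integration.integral_sum) auto
  also have "\<dots> = (\<Sum>c<n. V l c * (\<integral>w. f' c w \<partial>\<mu>))"
  proof (intro sum.cong refl arg_cong2[of _ _ _ _ "(*)"])
    fix c assume "c \<in> {..<n}"
    then show "(\<integral>w. w (c, j) * f w \<partial>\<mu>) = (\<integral>w. f' c w \<partial>\<mu>)"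
      by (intro gaussian_product_integral_by_parts[of Idx "(c, j)" f "f' c" C D]) (use assms in auto)
  qed
  also have "\<dots> = (\<integral>w. (\<Sum>c<n. V l c * f' c w) \<partial>\<mu>)"
    using i' by (subst Bochner_Integration.integral_sum) auto
  finally show ?thesis .
qed

text \<open>By orthonormality of the rows of \<open>V\<close>, the combined direction is the unit
  vector with index \<open>l\<close>. For \<open>l\<close> at least \<open>k\<close> it vanishes on
  all indices that \<open>dpinv\<close> reads.\<close>

lemma sum_V_dpinv:
  assumes "l < n"
  shows "(\<Sum>c<n. V l c * dpinv G j (\<lambda>d. V d c) b i) = dpinv G j (\<lambda>d. if l = d then 1 else 0) b i"
  unfolding dpinv_linear by (rule dpinv_cong) (use assms orthonormal k_le in auto)

lemma rot_dpinv_bound: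
  assumes "j < r" "b < r" "i < k" "c < n"
  shows "\<bar>dpinv (rot w) j (\<lambda>d. V d c) b i\<bar> \<le> (k * bnd + k * bnd * bnd + k * bnd * (k * bnd)) * coord_norm Idx w"
  by (rule dpinv_bound) (use assms V_le k_le rot_le coord_norm_ge_1 in auto)

lemma DERIV_rot_pinv:
  assumes "c < n" "j < r" "b < r" "i < k"
  shows "((\<lambda>y. pinv (rot (w((c, j) := y))) b i) has_field_derivative dpinv (rot (w((c, j) := y))) j (\<lambda>d. V d c) b i) (at y)"
    and "isCont (\<lambda>y. dpinv (rot (w((c, j) := y))) j (\<lambda>d. V d c) b i) y"
  by (rule DERIV_pinv isCont_dpinv; use assms DERIV_rot in auto)+

lemma integrable_rot_bounded:
  fixes f :: "_ \<Rightarrow> real" and C :: real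
  assumes "f \<in> borel_measurable \<mu>" "\<And>w. \<bar>f w\<bar> \<le> C"
  shows "integrable \<mu> f"
proof -
  interpret prob_space \<mu> by (rule prob_space_gaussian_product)
  show ?thesis using assms by (intro integrable_const_bound[of _ C]) auto
qed

lemma integrable_rot_quadratic_bound:
  fixes f :: "_ \<Rightarrow> real" and D :: real
  assumes "f \<in> borel_measurable \<mu>" "\<And>w. \<bar>f w\<bar> \<le> D * (coord_norm Idx w)\<^sup>2"
  shows "integrable \<mu> f"
  by (rule integrable_gaussian_product_quadratic_bound) (use assms in auto)

lemma gtrace_rot:
  "integrable \<mu> (\<lambda>w. gtrace (rot w))" "0 \<le> (\<integral>w. gtrace (rot w) \<partial>\<mu>)"
proof -
  show "integrable \<mu> (\<lambda>w. gtrace (rot w))"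
    unfolding gtrace_def
    by (intro Bochner_Integration.integrable_sum integrable_rot_bounded[of _ bnd] borel_measurable_rot_ginv bnd) auto
  show "0 \<le> (\<integral>w. gtrace (rot w) \<partial>\<mu>)" by (simp add: gtrace_nonneg)
qed

text \<open>The mean of tr (G P) is evaluated twice. Algebraically the trace is k - \<epsilon> tr K,
  hence at most k; by parts its mean is that of the divergence of P, which is at least (r - k - 1)
  times the mean of tr K.\<close>

lemma expectation_gtrace:
  "(real r - real k - 1) * (\<integral>w. gtrace (rot w) \<partial>\<mu>) \<le> k"
proof -
  interpret prob_space \<mu> by (rule prob_space_gaussian_product)
  let ?e = "\<lambda>i d. if i = d then 1 else 0 :: real"
  have parts: "(\<integral>w. rot w i j * pinv (rot w) j i \<partial>\<mu>) = (\<integral>w. dpinv (rot w) j (?e i) j i \<partial>\<mu>)"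
    if ij: "i < k" "j < r" for i j
  proof -
    have i: "i < n" using ij k_le by simp
    let ?D = "k * bnd + k * bnd * bnd + k * bnd * (k * bnd)"
    have D: "0 \<le> ?D" using bnd(1) by simp
    have "(\<integral>w. rot w i j * pinv (rot w) j i \<partial>\<mu>) = (\<integral>w. (\<Sum>c<n. V i c * dpinv (rot w) j (\<lambda>d. V d c) j i) \<partial>\<mu>)"
    proof (rule rot_integral_by_parts[OF ij(2)])
      fix w
      show "\<bar>pinv (rot w) j i\<bar> \<le> bnd * coord_norm Idx w"
        using bnd(3)[OF ij(2,1), of "rot w"] bnd_le_coord_norm[of Idx w] by linarith
      fix c assume c: "c < n"
      have "\<bar>dpinv (rot w) j (\<lambda>d. V d c) j i\<bar> \<le> ?D * coord_norm Idx w"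
        using rot_dpinv_bound ij c by blast
      also have "\<dots> \<le> ?D * (coord_norm Idx w)\<^sup>2"
        using D self_le_power[OF coord_norm_ge_1[of Idx w], of 2] by (intro mult_left_mono) auto
      finally show "\<bar>dpinv (rot w) j (\<lambda>d. V d c) j i\<bar> \<le> ?D * (coord_norm Idx w)\<^sup>2" .
    qed (use ij in \<open>auto intro: borel_measurable_rot_pinv borel_measurable_rot_dpinv DERIV_rot_pinv\<close>)
    then show ?thesis by (simp add: sum_V_dpinv[OF i])
  qed
  have i1: "integrable \<mu> (\<lambda>w. rot w i j * pinv (rot w) j i)" if "i < k" "j < r" for i j
  proof (rule integrable_rot_quadratic_bound[of _ bnd])
    fix w
    have "\<bar>rot w i j\<bar> * \<bar>pinv (rot w) j i\<bar> \<le> coord_norm Idx w * (bnd * coord_norm Idx w)"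
      using rot_le[of i j w] that k_le order_trans[OF bnd(3)[OF that(2,1)] bnd_le_coord_norm[of Idx w], of "rot w"]
        coord_norm_ge_1[of Idx w]
      by (intro mult_mono) auto
    then show "\<bar>rot w i j * pinv (rot w) j i\<bar> \<le> bnd * (coord_norm Idx w)\<^sup>2"
      by (simp add: abs_mult power2_eq_square mult_ac)
  qed (use that in \<open>auto intro!: borel_measurable_times borel_measurable_rot borel_measurable_rot_pinv\<close>)
  have i2: "integrable \<mu> (\<lambda>w. dpinv (rot w) j (?e i) j i)" if "i < k" "j < r" for i j
  proof (rule integrable_rot_quadratic_bound)
    fix w
    let ?D = "k * bnd + k * bnd * bnd + k * bnd * (k * bnd)"
    have "\<bar>dpinv (rot w) j (?e i) j i\<bar> \<le> ?D * coord_norm Idx w"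
      by (rule dpinv_bound) (use that k_le rot_le coord_norm_ge_1 in auto)
    also have "\<dots> \<le> ?D * (coord_norm Idx w)\<^sup>2"
      using bnd(1) self_le_power[OF coord_norm_ge_1[of Idx w], of 2] by (intro mult_left_mono) auto
    finally show "\<bar>dpinv (rot w) j (?e i) j i\<bar> \<le> ?D * (coord_norm Idx w)\<^sup>2" .
  qed (use that in \<open>auto intro: borel_measurable_rot_dpinv\<close>)
  have "(real r - real k - 1) * (\<integral>w. gtrace (rot w) \<partial>\<mu>) = (\<integral>w. (real r - real k - 1) * gtrace (rot w) \<partial>\<mu>)"
    by simp
  also have "\<dots> \<le> (\<integral>w. (\<Sum>i<k. \<Sum>j<r. dpinv (rot w) j (?e i) j i) \<partial>\<mu>)"
    using i2 gtrace_rot(1) sum_dpinv_ge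
    by (intro integral_mono Bochner_Integration.integrable_sum integrable_mult_right) auto
  also have "\<dots> = (\<Sum>i<k. \<Sum>j<r. (\<integral>w. dpinv (rot w) j (?e i) j i \<partial>\<mu>))"
    using i2 by (intro integral_sum_sum) auto
  also have "\<dots> = (\<Sum>i<k. \<Sum>j<r. (\<integral>w. rot w i j * pinv (rot w) j i \<partial>\<mu>))"
    using parts by simp
  also have "\<dots> = (\<integral>w. (\<Sum>i<k. \<Sum>j<r. rot w i j * pinv (rot w) j i) \<partial>\<mu>)"
    using i1 by (intro integral_sum_sum[symmetric]) auto
  also have "\<dots> \<le> (\<integral>w. real k \<partial>\<mu>)"
    using i1 gtrace_nonneg eps_pos
    by (intro integral_mono Bochner_Integration.integrable_sum integrable_const) (auto simp: sum_pinv)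
  finally show ?thesis by (simp add: prob_space)
qed

text \<open>A trailing row of V^T \<Omega> is standard normal and independent of G, so its product
  with a column of P has the mean square of that column's length. Integration by parts expresses the
  independence as follows: a move along row \<open>l\<close> leaves G unchanged, so only the
  explicit factor \<open>rot w l\<close> contributes a derivative.\<close>

lemma expectation_rot_pinv_square:
  assumes l: "k \<le> l" "l < n" and i: "i < k"
  shows "integrable \<mu> (\<lambda>w. (\<Sum>j<r. rot w l j * pinv (rot w) j i)\<^sup>2)"
    and "(\<integral>w. (\<Sum>j<r. rot w l j * pinv (rot w) j i)\<^sup>2 \<partial>\<mu>) = (\<integral>w. (\<Sum>j<r. (pinv (rot w) j i)\<^sup>2) \<partial>\<mu>)"
proof -
  let ?N = "coord_norm Idx"
  let ?X = "\<lambda>w. \<Sum>b<r. rot w l b * pinv (rot w) b i"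
  let ?D = "k * bnd + k * bnd * bnd + k * bnd * (k * bnd)"
  have D: "0 \<le> ?D" using bnd(1) by simp
  have N: "1 \<le> ?N w" for w by (rule coord_norm_ge_1)
  have X: "\<bar>?X w\<bar> \<le> r * (?N w * bnd)" for w
    using abs_sum_mult_le[of "{..<r}" "rot w l" "?N w" "\<lambda>b. pinv (rot w) b i" bnd] rot_le[OF l(2)] bnd(3)[OF _ i] N[of w]
    by simp
  have mX: "?X \<in> borel_measurable \<mu>"
    using i by (auto intro!: borel_measurable_sum borel_measurable_times borel_measurable_rot borel_measurable_rot_pinv)
  show int: "integrable \<mu> (\<lambda>w. (?X w)\<^sup>2)"
  proof (rule integrable_rot_quadratic_bound)
    show "\<bar>(?X w)\<^sup>2\<bar> \<le> (r * bnd)\<^sup>2 * (?N w)\<^sup>2" for w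
      using power_mono[OF X[of w], of 2] by (simp add: power_mult_distrib mult_ac)
  qed (use mX in simp)
  \<comment> \<open>One factor of the square \<open>?X\<close> is expanded over \<open>j\<close>.
    What remains beside \<open>rot w l j\<close> is \<open>pinv (rot w) j i * ?X w\<close>, and this
    is its derivative in the entry (c, j) by the product rule.\<close>
  define f' where "f' j c w = dpinv (rot w) j (\<lambda>d. V d c) j i * ?X w +
    pinv (rot w) j i * (\<Sum>b<r. (if b = j then V l c else 0) * pinv (rot w) b i + rot w l b * dpinv (rot w) j (\<lambda>d. V d c) b i)" for j c and w :: "nat \<times> nat \<Rightarrow> real"
  have parts: "(\<integral>w. rot w l j * (pinv (rot w) j i * ?X w) \<partial>\<mu>) = (\<integral>w. (pinv (rot w) j i)\<^sup>2 \<partial>\<mu>)"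
    if j: "j < r" for j
  proof -
    have "(\<integral>w. rot w l j * (pinv (rot w) j i * ?X w) \<partial>\<mu>) = (\<integral>w. (\<Sum>c<n. V l c * f' j c w) \<partial>\<mu>)"
    proof (rule rot_integral_by_parts[OF j])
      show "(\<lambda>w. pinv (rot w) j i * ?X w) \<in> borel_measurable \<mu>"
        using mX i j by (intro borel_measurable_times borel_measurable_rot_pinv)
      fix w
      have "\<bar>pinv (rot w) j i * ?X w\<bar> \<le> bnd * (r * (?N w * bnd))"
        unfolding abs_mult using X[of w] bnd(1) bnd(3)[OF j i] by (intro mult_mono) auto
      then show "\<bar>pinv (rot w) j i * ?X w\<bar> \<le> bnd * r * bnd * ?N w" by (simp add: mult_ac)
      fix c assume c: "c < n"
      show "f' j c \<in> borel_measurable \<mu>"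
        unfolding f'_def using mX i j
        by (intro borel_measurable_times borel_measurable_add borel_measurable_sum borel_measurable_rot
            borel_measurable_rot_pinv borel_measurable_rot_dpinv borel_measurable_const) auto
      note d1 = DERIV_rot_pinv(1)[OF c j _ i, where w = w] and d2 = DERIV_rot_pinv(2)[OF c j _ i, where w = w]
        and d3 = DERIV_rot[OF c, where w = w and j = j and l = l]
      show "((\<lambda>y. pinv (rot (w((c, j) := y))) j i * ?X (w((c, j) := y))) has_field_derivative f' j c (w((c, j) := y))) (at y)" for y
      proof -
        have "((\<lambda>y. ?X (w((c, j) := y))) has_field_derivative
          (\<Sum>b<r. (if b = j then V l c else 0) * pinv (rot (w((c, j) := y))) b i + dpinv (rot (w((c, j) := y))) j (\<lambda>d. V d c) b i * rot (w((c, j) := y)) l b)) (at y)"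
          by (intro DERIV_sum DERIV_mult d1 d3) auto
        from DERIV_mult[OF d1[OF j] this] show ?thesis unfolding f'_def by (simp add: mult_ac)
      qed
      have c1: "isCont (\<lambda>y. pinv (rot (w((c, j) := y))) b i) y" if "b < r" for b y using DERIV_isCont[OF d1[OF that]] .
      have c3: "isCont (\<lambda>y. rot (w((c, j) := y)) l b) y" for b y using DERIV_isCont[OF d3] .
      show "isCont (\<lambda>y. f' j c (w((c, j) := y))) y" for y
        unfolding f'_def using j
        by (intro continuous_add continuous_mult continuous_sum continuous_const c1 c3 d2) auto
      have d: "\<bar>dpinv (rot w) j (\<lambda>d. V d c) b i\<bar> \<le> ?D * ?N w" if "b < r" for b
        using rot_dpinv_bound[OF j that i c] .
      have 1: "\<bar>dpinv (rot w) j (\<lambda>d. V d c) j i * ?X w\<bar> \<le> ?D * ?N w * (r * (?N w * bnd))"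
        unfolding abs_mult using D N[of w] X[of w] d[OF j] by (intro mult_mono) auto
      have 2: "\<bar>pinv (rot w) j i * (\<Sum>b<r. (if b = j then V l c else 0) * pinv (rot w) b i)\<bar> \<le> bnd * bnd"
      proof -
        have "(\<Sum>b<r. (if b = j then V l c else 0) * pinv (rot w) b i) = V l c * pinv (rot w) j i"
          using j by (simp add: if_distribR if_distrib[of "\<lambda>x. x * _"] sum.delta cong: if_cong)
        moreover have "\<bar>V l c * pinv (rot w) j i\<bar> \<le> 1 * bnd"
          unfolding abs_mult using V_le[OF l(2) c] bnd(3)[OF j i] by (intro mult_mono) auto
        ultimately show ?thesis
          unfolding abs_mult using bnd(1) bnd(3)[OF j i, of "rot w"] by (intro mult_mono) (auto simp: abs_mult)
      qed
      have "bnd * bnd * 1 \<le> bnd * bnd * (?N w)\<^sup>2"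
        using bnd(1) N[of w] by (intro mult_left_mono one_le_power) auto
      note 2 = order_trans[OF 2 this[unfolded mult_1_right]]
      have "\<bar>\<Sum>b<r. rot w l b * dpinv (rot w) j (\<lambda>d. V d c) b i\<bar> \<le> r * (?N w * (?D * ?N w))"
        using abs_sum_mult_le[of "{..<r}" "rot w l" "?N w" "\<lambda>b. dpinv (rot w) j (\<lambda>d. V d c) b i" "?D * ?N w"] rot_le[OF l(2)] d N[of w]
        by simp
      then have 3: "\<bar>pinv (rot w) j i * (\<Sum>b<r. rot w l b * dpinv (rot w) j (\<lambda>d. V d c) b i)\<bar> \<le> bnd * (r * (?N w * (?D * ?N w)))"
        unfolding abs_mult using bnd(1) bnd(3)[OF j i] by (intro mult_mono) auto
      have "f' j c w = dpinv (rot w) j (\<lambda>d. V d c) j i * ?X w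
        + pinv (rot w) j i * (\<Sum>b<r. (if b = j then V l c else 0) * pinv (rot w) b i)
        + pinv (rot w) j i * (\<Sum>b<r. rot w l b * dpinv (rot w) j (\<lambda>d. V d c) b i)"
        unfolding f'_def by (simp add: sum.distrib distrib_left)
      then have "\<bar>f' j c w\<bar> \<le> ?D * ?N w * (r * (?N w * bnd)) + bnd * bnd * (?N w)\<^sup>2 + bnd * (r * (?N w * (?D * ?N w)))"
        using 1 2 3 by linarith
      also have "\<dots> = (?D * r * bnd + bnd * bnd + bnd * r * ?D) * (?N w)\<^sup>2"
        by (simp add: power2_eq_square algebra_simps)
      finally show "\<bar>f' j c w\<bar> \<le> (?D * r * bnd + bnd * bnd + bnd * r * ?D) * (?N w)\<^sup>2" .
    qed
    moreover have "(\<Sum>c<n. V l c * f' j c w) = (pinv (rot w) j i)\<^sup>2" for w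
    proof -
      let ?d = "\<lambda>b c. dpinv (rot w) j (\<lambda>d. V d c) b i"
      \<comment> \<open>Since l \<ge> k, the direction of row \<open>l\<close> has no component
        among the leading rows, so \<open>pinv\<close> does not change along it.\<close>
      have z: "(\<Sum>c<n. V l c * ?d b c) = 0" for b
      proof -
        have "(\<Sum>c<n. V l c * ?d b c) = dpinv (rot w) j (\<lambda>d. 0) b i"
          unfolding sum_V_dpinv[OF l(2)] by (rule dpinv_cong) (use l in auto)
        then show ?thesis by (simp add: dpinv_def)
      qed
      have f': "f' j c w = ?d j c * ?X w + V l c * (pinv (rot w) j i)\<^sup>2 + (\<Sum>b<r. pinv (rot w) j i * rot w l b * ?d b c)" for c
        unfolding f'_def using j
        by (simp add: sum.distrib distrib_left if_distribR if_distrib[of "\<lambda>x. x * _"] sum.delta sum_distrib_left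
            power2_eq_square mult_ac cong: if_cong)
      have "(\<Sum>c<n. V l c * f' j c w) = (\<Sum>c<n. V l c * ?d j c) * ?X w + (\<Sum>c<n. V l c * V l c) * (pinv (rot w) j i)\<^sup>2
        + (\<Sum>b<r. pinv (rot w) j i * rot w l b * (\<Sum>c<n. V l c * ?d b c))"
      proof -
        have "(\<Sum>c<n. V l c * (\<Sum>b<r. pinv (rot w) j i * rot w l b * ?d b c)) = (\<Sum>b<r. pinv (rot w) j i * rot w l b * (\<Sum>c<n. V l c * ?d b c))"
          unfolding sum_distrib_left by (subst sum.swap) (simp add: mult_ac)
        then show ?thesis unfolding f' distrib_left sum.distrib by (simp only: sum_distrib_right mult.assoc)
      qed
      then show ?thesis using orthonormal[OF l(2) l(2)] by (simp add: z)
    qed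
    ultimately show ?thesis by simp
  qed
  have i1: "integrable \<mu> (\<lambda>w. rot w l j * (pinv (rot w) j i * ?X w))" if j: "j < r" for j
  proof (rule integrable_rot_quadratic_bound)
    fix w
    have "\<bar>rot w l j * (pinv (rot w) j i * ?X w)\<bar> \<le> ?N w * (bnd * (r * (?N w * bnd)))"
      unfolding abs_mult using rot_le[OF l(2) j] X[of w] bnd(1) bnd(3)[OF j i] N[of w] by (intro mult_mono) auto
    then show "\<bar>rot w l j * (pinv (rot w) j i * ?X w)\<bar> \<le> bnd * r * bnd * (?N w)\<^sup>2"
      by (simp add: power2_eq_square mult_ac)
    show "(\<lambda>w. rot w l j * (pinv (rot w) j i * ?X w)) \<in> borel_measurable \<mu>"
      using mX i j by (intro borel_measurable_times borel_measurable_rot_pinv borel_measurable_rot)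
  qed
  have i2: "integrable \<mu> (\<lambda>w. (pinv (rot w) j i)\<^sup>2)" if j: "j < r" for j
  proof (rule integrable_rot_bounded)
    show "\<bar>(pinv (rot w) j i)\<^sup>2\<bar> \<le> bnd\<^sup>2" for w
      using bnd(3)[OF j i, of "rot w"] bnd(1) power_mono[of "\<bar>pinv (rot w) j i\<bar>" bnd 2] by simp
  qed (use i j in \<open>auto intro!: borel_measurable_power borel_measurable_rot_pinv\<close>)
  have "(\<integral>w. (?X w)\<^sup>2 \<partial>\<mu>) = (\<integral>w. (\<Sum>j<r. rot w l j * (pinv (rot w) j i * ?X w)) \<partial>\<mu>)"
    by (simp add: power2_eq_square sum_distrib_right mult.assoc)
  also have "\<dots> = (\<Sum>j<r. (\<integral>w. (pinv (rot w) j i)\<^sup>2 \<partial>\<mu>))"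
    using i1 parts by (simp add: Bochner_Integration.integral_sum)
  also have "\<dots> = (\<integral>w. (\<Sum>j<r. (pinv (rot w) j i)\<^sup>2) \<partial>\<mu>)"
    using i2 by (simp add: Bochner_Integration.integral_sum)
  finally show "(\<integral>w. (?X w)\<^sup>2 \<partial>\<mu>) = (\<integral>w. (\<Sum>j<r. (pinv (rot w) j i)\<^sup>2) \<partial>\<mu>)" .
qed

text \<open>The squared error of the regularised approximation in the eigenbasis, with eigenvalues
  \<open>\<nu>\<close> of A^T A as weights. The first sum is the truncation error together with its
  amplification, the second the bias from \<epsilon>.\<close>

definition residual :: "(nat \<Rightarrow> real) \<Rightarrow> (nat \<times> nat \<Rightarrow> real) \<Rightarrow> real" where
  "residual \<nu> w = (\<Sum>l\<in>{k..<n}. \<nu> l * (1 + (\<Sum>i<k. (\<Sum>j<r. rot w l j * pinv (rot w) j i)\<^sup>2)))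
     + (\<Sum>l<k. \<nu> l * (\<Sum>i<k. (\<epsilon> * ginv (rot w) l i)\<^sup>2))"

text \<open>The approximation has only \<open>k\<close> nonzero columns. A trailing row therefore
  keeps its diagonal 1, while in the leading block \<open>pinv_ginv\<close> leaves exactly
  \<epsilon> \<open>ginv\<close>.\<close>

lemma residual_eq:
  "(\<Sum>l<n. \<nu> l * (\<Sum>i<n. ((if l = i then 1 else 0) - (if i < k then \<Sum>j<r. rot w l j * pinv (rot w) j i else 0))\<^sup>2))
    = residual \<nu> w"
proof -
  let ?X = "\<lambda>l i. \<Sum>j<r. rot w l j * pinv (rot w) j i"
  let ?E = "\<lambda>l i. ((if l = i then 1 else 0) - (if i < k then ?X l i else 0))\<^sup>2"
  have n: "{..<n} = {..<k} \<union> {k..<n}" "{..<k} \<inter> {k..<n} = {}" using k_le by auto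
  have split: "(\<Sum>l<n. f l) = (\<Sum>l<k. f l) + (\<Sum>l\<in>{k..<n}. f l)" for f :: "nat \<Rightarrow> real"
    unfolding n(1) by (rule sum.union_disjoint) (use n(2) in auto)
  have 1: "(\<Sum>i<n. ?E l i) = 1 + (\<Sum>i<k. (?X l i)\<^sup>2)" if "l \<in> {k..<n}" for l
  proof -
    have "(\<Sum>i<k. ?E l i) = (\<Sum>i<k. (?X l i)\<^sup>2)" using that by (intro sum.cong) auto
    moreover have "(\<Sum>i\<in>{k..<n}. ?E l i) = (\<Sum>i\<in>{k..<n}. if i = l then 1 else 0)" by (intro sum.cong) auto
    ultimately show ?thesis unfolding split using that by simp
  qed
  have 2: "(\<Sum>i<n. ?E l i) = (\<Sum>i<k. (\<epsilon> * ginv (rot w) l i)\<^sup>2)" if "l \<in> {..<k}" for l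
  proof -
    have "(\<Sum>i<k. ?E l i) = (\<Sum>i<k. (\<epsilon> * ginv (rot w) l i)\<^sup>2)"
      using that by (intro sum.cong) (auto simp: pinv_ginv)
    moreover have "(\<Sum>i\<in>{k..<n}. ?E l i) = 0" using that by (intro sum.neutral) auto
    ultimately show ?thesis unfolding split by simp
  qed
  show ?thesis unfolding residual_def split[of "\<lambda>l. \<nu> l * _ l"] using 1 2 by simp
qed

text \<open>Each trailing eigenvalue is weighted by at most 1 + E tr K. In the bias one \<epsilon>
  is used up in bounding \<epsilon> |K|^2 by tr K, and the other survives as the factor that tends
  to 0. The condition on \<open>r\<close> makes r - k - 1 positive.\<close>

lemma expectation_residual:
  fixes \<Lambda> :: real
  assumes \<nu>: "\<And>l. l < n \<Longrightarrow> 0 \<le> \<nu> l" "\<And>l. l < k \<Longrightarrow> \<nu> l \<le> \<Lambda>" and \<Lambda>: "0 \<le> \<Lambda>" and r: "k + 2 \<le> r"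
  shows "integrable \<mu> (residual \<nu>)"
    and "(\<integral>w. residual \<nu> w \<partial>\<mu>) \<le> (1 + k / (real r - real k - 1)) * (\<Sum>l\<in>{k..<n}. \<nu> l) + \<epsilon> * (\<Lambda> * k / (real r - real k - 1))"
proof -
  interpret prob_space \<mu> by (rule prob_space_gaussian_product)
  let ?T = "\<lambda>w. gtrace (rot w)" and ?ET = "\<integral>w. gtrace (rot w) \<partial>\<mu>"
  let ?X = "\<lambda>l i w. (\<Sum>j<r. rot w l j * pinv (rot w) j i)\<^sup>2"
  let ?S = "\<lambda>l w. \<nu> l * (\<Sum>i<k. (\<epsilon> * ginv (rot w) l i)\<^sup>2)"
  have X: "integrable \<mu> (?X l i)" if "l \<in> {k..<n}" "i < k" for l i
    using expectation_rot_pinv_square(1)[of l i] that by auto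
  have S: "integrable \<mu> (?S l)" if "l < k" for l
  proof (intro integrable_mult_right Bochner_Integration.integrable_sum integrable_rot_bounded)
    fix i w assume i: "i \<in> {..<k}"
    have "\<bar>\<epsilon> * ginv (rot w) l i\<bar> \<le> \<epsilon> * bnd"
      unfolding abs_mult using bnd(2)[of l i "rot w"] that i eps_pos by (intro mult_mono) auto
    from power_mono[OF this, of 2] show "\<bar>(\<epsilon> * ginv (rot w) l i)\<^sup>2\<bar> \<le> (\<epsilon> * bnd)\<^sup>2" by simp
  qed (use that in \<open>auto intro!: borel_measurable_power borel_measurable_times borel_measurable_rot_ginv\<close>)
  have P: "integrable \<mu> (\<lambda>w. \<Sum>j<r. (pinv (rot w) j i)\<^sup>2)" if i: "i < k" for i
  proof (intro Bochner_Integration.integrable_sum integrable_rot_bounded)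
    fix j w assume j: "j \<in> {..<r}"
    show "\<bar>(pinv (rot w) j i)\<^sup>2\<bar> \<le> bnd\<^sup>2"
      using bnd(3)[of j i "rot w"] i j bnd(1) power_mono[of "\<bar>pinv (rot w) j i\<bar>" bnd 2] by simp
  qed (use i in \<open>auto intro!: borel_measurable_power borel_measurable_rot_pinv\<close>)
  show int: "integrable \<mu> (residual \<nu>)"
    unfolding residual_def[abs_def]
  proof (rule Bochner_Integration.integrable_add)
    show "integrable \<mu> (\<lambda>w. \<Sum>l<k. ?S l w)" using S by (intro Bochner_Integration.integrable_sum) auto
  qed (use X in \<open>intro Bochner_Integration.integrable_add Bochner_Integration.integrable_sum integrable_mult_right integrable_const, auto\<close>)
  have r': "0 < real r - real k - 1" using r by linarith
  have ET: "?ET \<le> k / (real r - real k - 1)" "0 \<le> ?ET"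
    using expectation_gtrace gtrace_rot(2) r' by (auto simp: pos_le_divide_eq mult.commute)
  have 1: "(\<integral>w. \<nu> l * (1 + (\<Sum>i<k. ?X l i w)) \<partial>\<mu>) \<le> \<nu> l * (1 + ?ET)" if l: "l \<in> {k..<n}" for l
  proof -
    have eq: "(\<integral>w. \<nu> l * (1 + (\<Sum>i<k. ?X l i w)) \<partial>\<mu>) = \<nu> l * (1 + (\<Sum>i<k. \<integral>w. ?X l i w \<partial>\<mu>))"
    proof -
      have "integrable \<mu> (\<lambda>w. \<Sum>i<k. ?X l i w)" using X[OF l] by (intro Bochner_Integration.integrable_sum) auto
      moreover have "(\<integral>w. (\<Sum>i<k. ?X l i w) \<partial>\<mu>) = (\<Sum>i<k. \<integral>w. ?X l i w \<partial>\<mu>)"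
        using X[OF l] by (intro Bochner_Integration.integral_sum) auto
      ultimately show ?thesis by (simp add: prob_space)
    qed
    have "(\<Sum>i<k. \<integral>w. ?X l i w \<partial>\<mu>) = (\<Sum>i<k. \<integral>w. (\<Sum>j<r. (pinv (rot w) j i)\<^sup>2) \<partial>\<mu>)"
      using l by (intro sum.cong expectation_rot_pinv_square) auto
    also have "\<dots> = (\<integral>w. (\<Sum>i<k. \<Sum>j<r. (pinv (rot w) j i)\<^sup>2) \<partial>\<mu>)"
      using P by (simp add: Bochner_Integration.integral_sum)
    also have "\<dots> \<le> ?ET"
    proof (rule integral_mono)
      show "integrable \<mu> (\<lambda>w. \<Sum>i<k. \<Sum>j<r. (pinv (rot w) j i)\<^sup>2)"
        by (rule Bochner_Integration.integrable_sum) (use P in auto)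
    qed (use gtrace_rot(1) sum_pinv_square_le in auto)
    finally show ?thesis unfolding eq using \<nu>(1)[of l] l by (intro mult_left_mono add_left_mono) auto
  qed
  have 2: "(\<integral>w. (\<Sum>l<k. ?S l w) \<partial>\<mu>) \<le> (\<integral>w. \<Lambda> * \<epsilon> * ?T w \<partial>\<mu>)"
  proof (rule integral_mono)
    fix w
    have "(\<Sum>l<k. ?S l w) \<le> (\<Sum>l<k. \<Lambda> * (\<Sum>i<k. (\<epsilon> * ginv (rot w) l i)\<^sup>2))"
      using \<nu>(2) by (intro sum_mono mult_right_mono sum_nonneg) auto
    also have "\<dots> = \<Lambda> * \<epsilon> * (\<epsilon> * (\<Sum>i<k. \<Sum>l<k. (ginv (rot w) l i)\<^sup>2))"
    proof -
      have sw: "(\<Sum>i<k. \<Sum>l<k. (ginv (rot w) l i)\<^sup>2) = (\<Sum>l<k. \<Sum>i<k. (ginv (rot w) l i)\<^sup>2)"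
        by (rule sum.swap)
      show ?thesis unfolding sw by (simp add: sum_distrib_left power_mult_distrib power2_eq_square mult_ac)
    qed
    also have "\<dots> \<le> \<Lambda> * \<epsilon> * ?T w"
      using \<Lambda> sum_ginv_square_le eps_pos by (intro mult_left_mono) auto
    finally show "(\<Sum>l<k. ?S l w) \<le> \<Lambda> * \<epsilon> * ?T w" .
  qed (use S gtrace_rot(1) in auto)
  have X': "integrable \<mu> (\<lambda>w. \<nu> l * (1 + (\<Sum>i<k. ?X l i w)))" if "l \<in> {k..<n}" for l
    using X that by (intro Bochner_Integration.integrable_add Bochner_Integration.integrable_sum integrable_mult_right integrable_const) auto
  have "(\<integral>w. residual \<nu> w \<partial>\<mu>) = (\<Sum>l\<in>{k..<n}. \<integral>w. \<nu> l * (1 + (\<Sum>i<k. ?X l i w)) \<partial>\<mu>) + (\<integral>w. (\<Sum>l<k. ?S l w) \<partial>\<mu>)"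
    unfolding residual_def
  proof (subst Bochner_Integration.integral_add)
    show "integrable \<mu> (\<lambda>w. \<Sum>l<k. ?S l w)" using S by (intro Bochner_Integration.integrable_sum) auto
    show "integrable \<mu> (\<lambda>w. \<Sum>l\<in>{k..<n}. \<nu> l * (1 + (\<Sum>i<k. ?X l i w)))"
      using X' by (intro Bochner_Integration.integrable_sum)
  qed (simp only: Bochner_Integration.integral_sum[OF X'])
  also have "\<dots> \<le> (\<Sum>l\<in>{k..<n}. \<nu> l * (1 + ?ET)) + \<Lambda> * \<epsilon> * ?ET"
    using 1 2 by (intro add_mono sum_mono) auto
  also have "\<dots> \<le> (\<Sum>l\<in>{k..<n}. \<nu> l * (1 + k / (real r - real k - 1))) + \<Lambda> * \<epsilon> * (k / (real r - real k - 1))"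
    using \<nu>(1) ET \<Lambda> eps_pos by (intro add_mono sum_mono mult_left_mono) auto
  finally show "(\<integral>w. residual \<nu> w \<partial>\<mu>) \<le> (1 + k / (real r - real k - 1)) * (\<Sum>l\<in>{k..<n}. \<nu> l) + \<epsilon> * (\<Lambda> * k / (real r - real k - 1))"
    by (simp add: sum_distrib_left sum_distrib_right mult_ac)
qed

end

section \<open>Frobenius norm and projections\<close>

lemma frobenius_norm_sq: "(frobenius_norm A)\<^sup>2 = (\<Sum>i<dim_row A. \<Sum>j<dim_col A. (A $$ (i, j))\<^sup>2)"
  by (simp add: frobenius_norm_def sum_nonneg)

lemma frobenius_norm_sq_gram:
  "(frobenius_norm A)\<^sup>2 = (\<Sum>j<dim_col A. (transpose_mat A * A) $$ (j, j))"
proof -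
  have "(transpose_mat A * A) $$ (j, j) = (\<Sum>i<dim_row A. (A $$ (i, j))\<^sup>2)" if "j < dim_col A" for j
    using that by (simp add: scalar_prod_def lessThan_atLeast0 power2_eq_square)
  then show ?thesis unfolding frobenius_norm_sq by (subst sum.swap) simp
qed

lemma frobenius_norm_transpose: "frobenius_norm (transpose_mat A) = frobenius_norm A"
  unfolding frobenius_norm_def by (subst sum.swap) simp

lemma frobenius_norm_mult_orthogonal:
  assumes M: "M \<in> carrier_mat m n" and V: "V \<in> carrier_mat n n" and VV: "V * transpose_mat V = 1\<^sub>m n"
  shows "(frobenius_norm (M * V))\<^sup>2 = (frobenius_norm M)\<^sup>2"
proof -
  have "(M * V) * transpose_mat (M * V) = M * V * (transpose_mat V * transpose_mat M)"
    using transpose_mult[OF M V] by simp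
  also have "\<dots> = M * (V * (transpose_mat V * transpose_mat M))"
    using M V by (intro assoc_mult_mat) auto
  also have "V * (transpose_mat V * transpose_mat M) = V * transpose_mat V * transpose_mat M"
    using M V by (intro assoc_mult_mat[symmetric]) auto
  also have "M * \<dots> = M * transpose_mat M" unfolding VV using M by simp
  finally have *: "(M * V) * transpose_mat (M * V) = M * transpose_mat M" .
  show ?thesis
    using frobenius_norm_sq_gram[of "transpose_mat (M * V)"] frobenius_norm_sq_gram[of "transpose_mat M"] M V
    by (simp add: frobenius_norm_transpose *)
qed

text \<open>Pythagoras: N = R + W E with W^T R = 0, so the mixed terms of N^T N vanish.\<close>

lemma frobenius_norm_projection_le:
  assumes W: "W \<in> carrier_mat m r" "transpose_mat W * W = 1\<^sub>m r" and N: "N \<in> carrier_mat m n"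
  shows "(frobenius_norm (N - W * (transpose_mat W * N)))\<^sup>2 \<le> (frobenius_norm N)\<^sup>2"
proof -
  define E where "E = transpose_mat W * N"
  define R where "R = N - W * E"
  have E: "E \<in> carrier_mat r n" unfolding E_def using W N by simp
  have WE: "W * E \<in> carrier_mat m n" using W E by simp
  have R: "R \<in> carrier_mat m n" unfolding R_def using WE by (rule minus_carrier_mat)
  have "transpose_mat W * (W * E) = E"
    using W E assoc_mult_mat[of "transpose_mat W" r m W r E n] by simp
  then have WR: "transpose_mat W * R = 0\<^sub>m r n"
    unfolding R_def using W N WE E by (subst mult_minus_distrib_mat) (auto simp: E_def[symmetric])
  have "N = R + W * E" unfolding R_def using N WE by (intro eq_matI) auto
  then have "transpose_mat N * N = transpose_mat (R + W * E) * (R + W * E)" by simp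
  also have "\<dots> = (transpose_mat R + transpose_mat (W * E)) * (R + W * E)"
    using R WE by (subst transpose_add) auto
  also have "\<dots> = transpose_mat R * R + transpose_mat (W * E) * R + (transpose_mat R * (W * E) + transpose_mat (W * E) * (W * E))"
    using R WE by (simp add: add_mult_distrib_mat[of _ n m] mult_add_distrib_mat[of _ n m])
  also have "transpose_mat (W * E) * R = 0\<^sub>m n n"
    using W E R WR assoc_mult_mat[of "transpose_mat E" n r "transpose_mat W" m R n] transpose_mult[of W m r E n] by simp
  also have "transpose_mat R * (W * E) = 0\<^sub>m n n"
  proof -
    have "transpose_mat R * W = transpose_mat (transpose_mat W * R)" using W R transpose_mult[of "transpose_mat W" r m R n] by simp
    then have "transpose_mat R * W = 0\<^sub>m n r" unfolding WR by simp
    then show ?thesis using W E R assoc_mult_mat[of "transpose_mat R" n m W r E n] by simp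
  qed
  finally have *: "transpose_mat N * N = transpose_mat R * R + transpose_mat (W * E) * (W * E)"
    using R WE by simp
  have "(\<Sum>j<n. (transpose_mat N * N) $$ (j, j)) = (\<Sum>j<n. (transpose_mat R * R) $$ (j, j)) + (\<Sum>j<n. (transpose_mat (W * E) * (W * E)) $$ (j, j))"
    unfolding * sum.distrib[symmetric] using R W(1) E by (intro sum.cong) auto
  then have "(frobenius_norm N)\<^sup>2 = (frobenius_norm R)\<^sup>2 + (frobenius_norm (W * E))\<^sup>2"
    unfolding frobenius_norm_sq_gram using N R W(1) E by simp
  then show ?thesis unfolding R_def E_def by (metis add_increasing2 order_refl zero_le_power2)
qed

text \<open>The map I - W W^T annihilates W C X, so A and A - W C X have the same residual, and
  taking the residual does not increase the norm. Since W C will be the sketch A \<Omega>, any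
  \<open>X\<close> may be used as a competitor.\<close>

lemma projection_residual_le:
  assumes A: "A \<in> carrier_mat m n" and W: "W \<in> carrier_mat m r" "transpose_mat W * W = 1\<^sub>m r"
    and C: "C \<in> carrier_mat r r" and X: "X \<in> carrier_mat r n"
  shows "(frobenius_norm (A - W * (transpose_mat W * A)))\<^sup>2 \<le> (frobenius_norm (A - W * C * X))\<^sup>2"
proof -
  let ?N = "A - W * C * X"
  let ?D = "C * X"
  have D: "?D \<in> carrier_mat r n" using C X by simp
  have WD: "W * ?D \<in> carrier_mat m n" using W D by simp
  have N: "?N = A - W * ?D" using W C X by simp
  have "transpose_mat W * (W * ?D) = ?D"
    using W D assoc_mult_mat[of "transpose_mat W" r m W r ?D n] left_mult_one_mat[OF D] by simp
  then have "transpose_mat W * (A - W * ?D) = transpose_mat W * A - ?D"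
    using A W WD by (subst mult_minus_distrib_mat[of _ r m]) auto
  then have "W * (transpose_mat W * ?N) = W * (transpose_mat W * A) - W * ?D"
    unfolding N using mult_minus_distrib_mat[of W m r "transpose_mat W * A" n ?D] A W D by simp
  then have "?N - W * (transpose_mat W * ?N) = A - W * (transpose_mat W * A)"
    unfolding N using A W WD by (intro eq_matI) (auto simp del: index_mult_mat(1))
  moreover have "?N \<in> carrier_mat m n" unfolding N using WD by (rule minus_carrier_mat)
  ultimately show ?thesis using frobenius_norm_projection_le[OF W, of ?N n] by simp
qed

lemma transpose_mult_self:
  fixes A V :: "'a :: comm_ring_1 mat"
  assumes A: "A \<in> carrier_mat m n" and V: "V \<in> carrier_mat n r"
  shows "transpose_mat (A * V) * (A * V) = transpose_mat V * (transpose_mat A * A) * V"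
proof -
  have At: "transpose_mat A \<in> carrier_mat n m" and Vt: "transpose_mat V \<in> carrier_mat r n" using A V by auto
  have AV: "A * V \<in> carrier_mat m r" and AA: "transpose_mat A * A \<in> carrier_mat n n" using A V by auto
  have "transpose_mat (A * V) * (A * V) = transpose_mat V * (transpose_mat A * (A * V))"
    unfolding transpose_mult[OF A V] by (rule assoc_mult_mat[OF Vt At AV])
  then show ?thesis unfolding assoc_mult_mat[OF Vt AA V] assoc_mult_mat[OF At A V] .
qed

text \<open>Multiplication by the orthogonal \<open>V\<close> preserves the norm and turns the
  difference into A V (I - V^T X Z). The columns of A V are orthogonal with squared lengths
  \<open>\<nu>\<close>, so the squared norm is a weighted sum over entries.\<close>

lemma frobenius_norm_approximation:
  assumes A: "A \<in> carrier_mat m n" and V: "V \<in> carrier_mat n n" "transpose_mat V * V = 1\<^sub>m n"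
    and d: "transpose_mat V * (transpose_mat A * A) * V = mat n n (\<lambda>(i, j). if i = j then \<nu> i else 0)"
    and X: "X \<in> carrier_mat n r" and Z: "Z \<in> carrier_mat r n"
  shows "(frobenius_norm (A - A * X * (Z * transpose_mat V)))\<^sup>2
    = (\<Sum>l<n. \<nu> l * (\<Sum>i<n. ((if l = i then 1 else 0) - (transpose_mat V * X * Z) $$ (l, i))\<^sup>2))"
proof -
  let ?Vt = "transpose_mat V"
  have VV: "V * ?Vt = 1\<^sub>m n" using mat_mult_left_right_inverse[of ?Vt n V] V by simp
  define H where "H = ?Vt * X * Z"
  define N where "N = 1\<^sub>m n - H"
  have H: "H \<in> carrier_mat n n" unfolding H_def using V X Z by simp
  have N: "N \<in> carrier_mat n n" unfolding N_def using H by (simp add: minus_carrier_mat)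
  define M where "M = A - A * X * (Z * ?Vt)"
  have M: "M \<in> carrier_mat m n" unfolding M_def using A V X Z by (intro minus_carrier_mat mult_carrier_mat) auto
  have AV: "A * V \<in> carrier_mat m n" using A V by simp
  have AXZ: "A * X * (Z * ?Vt) \<in> carrier_mat m n" using A V X Z by (intro mult_carrier_mat) auto
  have "A * X * (Z * ?Vt) * V = A * X * (Z * ?Vt * V)"
    using A V X Z by (intro assoc_mult_mat) auto
  also have "Z * ?Vt * V = Z" using V Z assoc_mult_mat[of Z r n ?Vt n V n] by simp
  also have "A * X * Z = A * V * H"
  proof -
    have "A * V * H = A * (V * H)" using A V H by (intro assoc_mult_mat) auto
    also have "V * H = V * (?Vt * (X * Z))" unfolding H_def using V X Z by simp
    also have "\<dots> = V * ?Vt * (X * Z)" using V X Z by (intro assoc_mult_mat[symmetric]) auto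
    also have "\<dots> = X * Z" unfolding VV using X Z by simp
    finally show ?thesis using A X Z by simp
  qed
  finally have "M * V = A * V * N"
    using AXZ minus_mult_distrib_mat[of A m n "A * X * (Z * ?Vt)" V n] mult_minus_distrib_mat[of "A * V" m n "1\<^sub>m n" n H]
      A V X Z H AV right_mult_one_mat[OF AV] unfolding M_def N_def by simp
  moreover have "transpose_mat (A * V * N) * (A * V * N) = transpose_mat N * (mat n n (\<lambda>(i, j). if i = j then \<nu> i else 0) * N)"
  proof -
    have "transpose_mat (A * V * N) * (A * V * N) = transpose_mat N * transpose_mat (A * V) * (A * V * N)"
      using transpose_mult[OF AV N] by simp
    also have "\<dots> = transpose_mat N * (transpose_mat (A * V) * (A * V * N))"
      by (rule assoc_mult_mat[of _ n n _ m _ n]) (use AV N mult_carrier_mat[OF AV N] in auto)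
    also have "transpose_mat (A * V) * (A * V * N) = transpose_mat (A * V) * (A * V) * N"
      by (rule assoc_mult_mat[of _ n m _ n _ n, symmetric]) (use AV N in auto)
    also have "transpose_mat (A * V) * (A * V) = ?Vt * (transpose_mat A * A) * V"
      by (rule transpose_mult_self[OF A V(1)])
    finally show ?thesis unfolding d .
  qed
  moreover have "(transpose_mat N * (mat n n (\<lambda>(i, j). if i = j then \<nu> i else 0) * N)) $$ (i, i) = (\<Sum>l<n. \<nu> l * (N $$ (l, i))\<^sup>2)"
    if "i < n" for i
  proof -
    have "(mat n n (\<lambda>(i, j). if i = j then \<nu> i else 0) * N) $$ (l, i) = \<nu> l * N $$ (l, i)" if "l < n" for l
    proof -
      have "(mat n n (\<lambda>(i, j). if i = j then \<nu> i else 0) * N) $$ (l, i) = (\<Sum>j = 0..<n. (if l = j then \<nu> l else 0) * N $$ (j, i))"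
        using that \<open>i < n\<close> N by (simp add: scalar_prod_def)
      also have "\<dots> = (\<Sum>j = 0..<n. if j = l then \<nu> l * N $$ (l, i) else 0)" by (intro sum.cong) auto
      finally show ?thesis using that by simp
    qed
    then show ?thesis using that N
      by (simp add: scalar_prod_def lessThan_atLeast0 power2_eq_square mult_ac)
  qed
  ultimately have "(frobenius_norm (M * V))\<^sup>2 = (\<Sum>i<n. \<Sum>l<n. \<nu> l * (N $$ (l, i))\<^sup>2)"
    using AV N by (simp add: frobenius_norm_sq_gram)
  also have "\<dots> = (\<Sum>l<n. \<nu> l * (\<Sum>i<n. (N $$ (l, i))\<^sup>2))"
    by (subst sum.swap) (simp add: sum_distrib_left)
  also have "\<dots> = (\<Sum>l<n. \<nu> l * (\<Sum>i<n. ((if l = i then 1 else 0) - H $$ (l, i))\<^sup>2))"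
    using H by (intro sum.cong refl arg_cong2[of _ _ _ _ "(*)"]) (auto simp: N_def)
  finally have "(frobenius_norm M)\<^sup>2 = (\<Sum>l<n. \<nu> l * (\<Sum>i<n. ((if l = i then 1 else 0) - H $$ (l, i))\<^sup>2))"
    unfolding frobenius_norm_mult_orthogonal[OF M V(1) VV] .
  then show ?thesis unfolding M_def H_def .
qed

section \<open>Diagonalization and singular values\<close>

lemma mult_block_diagonal_mat:
  assumes "A \<in> carrier_mat a a" "D \<in> carrier_mat b b" "A' \<in> carrier_mat a a" "D' \<in> carrier_mat b b"
  shows "four_block_mat A (0\<^sub>m a b) (0\<^sub>m b a) D * four_block_mat A' (0\<^sub>m a b) (0\<^sub>m b a) D'
    = four_block_mat (A * A') (0\<^sub>m a b) (0\<^sub>m b a) (D * D')"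
proof -
  have z: "0\<^sub>m a b \<in> carrier_mat a b" "0\<^sub>m b a \<in> carrier_mat b a" by auto
  have "A * A' \<in> carrier_mat a a" "D * D' \<in> carrier_mat b b" using assms by auto
  then show ?thesis
    unfolding mult_four_block_mat[OF assms(1) z assms(2,3) z assms(4)] using assms by simp
qed

text \<open>Over the complex numbers the polynomial splits. For an eigenvector v with eigenvalue a,
  symmetry gives a |v|^2 = cnj a |v|^2, so all roots are real, and the factorization descends to the
  reals by comparing coefficients.\<close>

lemma real_symmetric_char_poly_splits:
  fixes A :: "real mat"
  assumes A: "A \<in> carrier_mat n n" and sym: "transpose_mat A = A"
  shows "\<exists>es. char_poly A = (\<Prod>e\<leftarrow>es. [:- e, 1:])"
proof -
  define B where "B = map_mat complex_of_real A"
  have B: "B \<in> carrier_mat n n" using A by (simp add: B_def)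
  obtain as where as: "char_poly B = (\<Prod>a\<leftarrow>as. [:- a, 1:])" using char_poly_factorized[OF B] by blast
  have real: "complex_of_real (Re a) = a" if "a \<in> set as" for a
  proof -
    have "poly (char_poly B) a = 0"
      using that unfolding as poly_prod_list by (auto simp: prod_list_zero_iff)
    then obtain v where v: "v \<in> carrier_vec n" "v \<noteq> 0\<^sub>v n" "B *\<^sub>v v = a \<cdot>\<^sub>v v"
      using eigenvalue_root_char_poly[OF B, of a] B by (auto simp: eigenvalue_def eigenvector_def)
    let ?s = "\<Sum>i<n. v $ i * cnj (v $ i)"
    have Bv: "(\<Sum>j<n. complex_of_real (A $$ (i, j)) * v $ j) = a * v $ i" if "i < n" for i
      using arg_cong[OF v(3), of "\<lambda>x. x $ i"] that v(1) A
      by (simp add: B_def scalar_prod_def lessThan_atLeast0)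
    have "a * ?s = (\<Sum>i<n. (a * v $ i) * cnj (v $ i))" by (simp add: sum_distrib_left mult.assoc)
    also have "\<dots> = (\<Sum>i<n. (\<Sum>j<n. complex_of_real (A $$ (i, j)) * v $ j) * cnj (v $ i))"
      using Bv by simp
    also have "\<dots> = (\<Sum>j<n. \<Sum>i<n. complex_of_real (A $$ (i, j)) * v $ j * cnj (v $ i))"
      by (simp add: sum_distrib_right) (rule sum.swap)
    also have "\<dots> = (\<Sum>j<n. v $ j * cnj (\<Sum>i<n. complex_of_real (A $$ (j, i)) * v $ i))"
    proof (intro sum.cong refl)
      fix j assume j: "j \<in> {..<n}"
      have "A $$ (i, j) = A $$ (j, i)" if "i < n" for i
        using arg_cong[OF sym, of "\<lambda>M. M $$ (j, i)"] that j A by simp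
      then show "(\<Sum>i<n. complex_of_real (A $$ (i, j)) * v $ j * cnj (v $ i)) = v $ j * cnj (\<Sum>i<n. complex_of_real (A $$ (j, i)) * v $ i)"
        by (simp add: sum_distrib_left mult_ac)
    qed
    also have "\<dots> = (\<Sum>j<n. v $ j * cnj (a * v $ j))" using Bv by simp
    also have "\<dots> = cnj a * ?s" by (simp add: sum_distrib_left mult_ac)
    finally have "a * ?s = cnj a * ?s" .
    moreover have "?s \<noteq> 0"
      using conjugate_square_eq_0_vec[OF v(1)] v(1,2) by (simp add: scalar_prod_def lessThan_atLeast0)
    ultimately have "a = cnj a" by simp
    then show ?thesis by (metis Reals_cnj_iff of_real_Re)
  qed
  have "map_poly complex_of_real (char_poly A) = char_poly B"
    unfolding B_def by (rule of_real_hom.char_poly_hom[OF A, symmetric])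
  also have "\<dots> = (\<Prod>a\<leftarrow>as. map_poly complex_of_real [:- Re a, 1:])"
    unfolding as using real by (intro arg_cong[of _ _ prod_list] map_cong) (auto simp: map_poly_pCons)
  also have "\<dots> = map_poly complex_of_real (\<Prod>a\<leftarrow>as. [:- Re a, 1:])"
  proof (induction as)
    interpret map_poly_comm_ring_hom complex_of_real ..
    case Nil
    then show ?case by simp
  next
    interpret map_poly_comm_ring_hom complex_of_real ..
    case (Cons a as)
    then show ?case by (simp only: list.map prod_list.Cons hom_mult)
  qed
  finally have eq: "map_poly complex_of_real (char_poly A) = map_poly complex_of_real (\<Prod>a\<leftarrow>as. [:- Re a, 1:])" .
  have "char_poly A = (\<Prod>a\<leftarrow>as. [:- Re a, 1:])"
  proof (rule poly_eqI)
    fix i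
    show "coeff (char_poly A) i = coeff (\<Prod>a\<leftarrow>as. [:- Re a, 1:]) i"
      using arg_cong[OF eq, of "\<lambda>p. coeff p i"]
      by (simp only: coeff_map_poly[of complex_of_real, OF of_real_0] of_real_eq_iff)
  qed
  then show ?thesis by (intro exI[of _ "map Re as"]) (simp only: map_map o_def)
qed

text \<open>Gram-Schmidt keeps the first vector of the completed basis, and normalisation only
  rescales it. A multiple of \<open>v\<close> is enough, as it is still an eigenvector when
  \<open>v\<close> is one.\<close>

lemma orthonormal_extension:
  fixes v :: "real vec"
  assumes v: "v \<in> carrier_vec n" "v \<noteq> 0\<^sub>v n"
  shows "\<exists>W c. W \<in> carrier_mat n n \<and> transpose_mat W * W = 1\<^sub>m n \<and> col W 0 = c \<cdot>\<^sub>v v"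
proof -
  interpret cof_vec_space n "TYPE(real)" .
  define b where "b = basis_completion v"
  from basis_completion[OF v, folded b_def]
  have b: "span (set b) = carrier_vec n" "distinct b" "\<not> lin_dep (set b)" "set b \<subseteq> carrier_vec n" "hd b = v" "length b = n"
    by auto
  define ws where "ws = gram_schmidt n b"
  from gram_schmidt_result[OF b(4,2,3) refl, folded ws_def]
  have ws: "set ws \<subseteq> carrier_vec n" "corthogonal ws" "length ws = n" by (auto simp: b(6))
  have n: "n \<noteq> 0" using v by auto
  then obtain vs where bv: "b = v # vs" using b(5,6) by (cases b) auto
  have hd: "ws ! 0 = v"
    using gram_schmidt_hd[OF v(1), of vs] ws(3) n unfolding ws_def bv by (subst hd_conv_nth[symmetric]) auto
  have wsc: "ws ! i \<in> carrier_vec n" if "i < n" for i using ws that by auto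
  have orth: "ws ! i \<bullet> ws ! j = 0 \<longleftrightarrow> i \<noteq> j" if "i < n" "j < n" for i j
    using corthogonalD[OF ws(2), of i j] that ws(3) by (simp add: conjugate_vec_def vec_eq_iff)
  define d where "d i = 1 / sqrt (ws ! i \<bullet> ws ! i)" for i
  define W where "W = mat_of_cols n (map (\<lambda>i. d i \<cdot>\<^sub>v ws ! i) [0..<n])"
  have W: "W \<in> carrier_mat n n" 
    unfolding W_def using mat_of_cols_carrier(1)[of n "map (\<lambda>i. d i \<cdot>\<^sub>v ws ! i) [0..<n]"] by simp
  have colW: "col W i = d i \<cdot>\<^sub>v ws ! i" if "i < n" for i
    unfolding W_def using that wsc[OF that] by (subst col_mat_of_cols) auto
  have "transpose_mat W * W = 1\<^sub>m n"
  proof (rule eq_matI)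
    fix i j assume "i < dim_row (1\<^sub>m n :: real mat)" "j < dim_col (1\<^sub>m n :: real mat)"
    then have ij: "i < n" "j < n" by auto
    have "(transpose_mat W * W) $$ (i, j) = d i * d j * (ws ! i \<bullet> ws ! j)"
    proof -
      have "(transpose_mat W * W) $$ (i, j) = col W i \<bullet> col W j" using W ij by simp
      also have "\<dots> = d i * (ws ! i \<bullet> (d j \<cdot>\<^sub>v ws ! j))"
        unfolding colW[OF ij(1)] colW[OF ij(2)] using wsc ij by (intro smult_scalar_prod_distrib[of _ n]) auto
      also have "ws ! i \<bullet> (d j \<cdot>\<^sub>v ws ! j) = d j * (ws ! i \<bullet> ws ! j)"
        using wsc ij by (intro scalar_prod_smult_distrib[of _ n]) auto
      finally show ?thesis by simp
    qed
    also have "\<dots> = (if i = j then 1 else 0)"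
    proof (cases "i = j")
      case True
      have "0 \<le> ws ! i \<bullet> ws ! i" by (simp add: scalar_prod_def sum_nonneg)
      moreover have "ws ! i \<bullet> ws ! i \<noteq> 0" using orth[OF ij(1) ij(1)] by simp
      ultimately show ?thesis using True by (simp add: d_def)
    next
      case False
      then show ?thesis using orth[OF ij] by simp
    qed
    finally show "(transpose_mat W * W) $$ (i, j) = 1\<^sub>m n $$ (i, j)" using ij by simp
  qed (use W in auto)
  then show ?thesis using W colW[of 0] n hd by auto
qed

text \<open>Deflation by induction on the list of roots: after a rotation that sends the first axis
  to an eigenvector, symmetry makes the matrix block diagonal. The order of \<open>es\<close> is
  arbitrary, so the decreasing order of the singular values can be prescribed later.\<close>

lemma real_symmetric_diagonalization:
  fixes A :: "real mat"
  assumes "A \<in> carrier_mat n n" "transpose_mat A = A" "char_poly A = (\<Prod>e\<leftarrow>es. [:- e, 1:])"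
  shows "\<exists>V. V \<in> carrier_mat n n \<and> transpose_mat V * V = 1\<^sub>m n \<and>
    transpose_mat V * A * V = mat n n (\<lambda>(i, j). if i = j then es ! i else 0)"
  using assms
proof (induction es arbitrary: n A)
  case Nil
  with degree_monic_char_poly[of A n] have "n = 0" by simp
  then show ?case using Nil by (intro exI[of _ "1\<^sub>m 0"]) (auto intro!: eq_matI)
next
  case (Cons e es n A)
  note A = Cons.prems(1) and sym = Cons.prems(2)
  have cp: "char_poly A = [:- e, 1:] * (\<Prod>e\<leftarrow>es. [:- e, 1:])" using Cons.prems(3) by simp
  have "eigenvalue A e" unfolding eigenvalue_root_char_poly[OF A] cp by simp
  then obtain v where v: "v \<in> carrier_vec n" "v \<noteq> 0\<^sub>v n" "A *\<^sub>v v = e \<cdot>\<^sub>v v"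
    using A by (auto simp: eigenvalue_def eigenvector_def)
  obtain W c where W: "W \<in> carrier_mat n n" "transpose_mat W * W = 1\<^sub>m n" "col W 0 = c \<cdot>\<^sub>v v"
    using orthonormal_extension[OF v(1,2)] by blast
  have n: "n \<noteq> 0" using v by auto
  then obtain n' where n': "n = Suc n'" by (cases n) auto
  let ?Wt = "transpose_mat W"
  have Wt: "?Wt \<in> carrier_mat n n" using W by simp
  have WW: "W * ?Wt = 1\<^sub>m n" using mat_mult_left_right_inverse[OF Wt W(1,2)] .
  define B where "B = ?Wt * A * W"
  have B: "B \<in> carrier_mat n n" unfolding B_def using W A by simp
  have Bsym: "transpose_mat B = B"
  proof -
    have "transpose_mat B = ?Wt * (transpose_mat A * W)"
      unfolding B_def using transpose_mult[of "?Wt * A" n n W n] transpose_mult[OF Wt A] W A by simp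
    then show ?thesis unfolding sym B_def using W A by simp
  qed
  have Bcol: "B $$ (i, 0) = (if i = 0 then e else 0)" if "i < n" for i
  proof -
    have "A *\<^sub>v col W 0 = e \<cdot>\<^sub>v col W 0"
      unfolding W(3) using v A by (simp add: mult_mat_vec smult_smult_assoc mult.commute)
    moreover have "col (A * W) 0 = A *\<^sub>v col W 0" using col_mult2[OF A W(1), of 0] n by simp
    ultimately have cA: "col (A * W) 0 = e \<cdot>\<^sub>v col W 0" by simp
    have "B $$ (i, 0) = row ?Wt i \<bullet> col (A * W) 0"
      unfolding B_def using A W(1) n that by simp
    also have "\<dots> = e * (row ?Wt i \<bullet> col W 0)"
      unfolding cA using W(1) that n by (intro scalar_prod_smult_distrib[of _ n]) auto
    also have "row ?Wt i \<bullet> col W 0 = (?Wt * W) $$ (i, 0)" using W(1) that n by simp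
    finally show ?thesis unfolding W(2) using that n by simp
  qed
  have Brow: "B $$ (0, j) = (if j = 0 then e else 0)" if "j < n" for j
    using Bcol[OF that] arg_cong[OF Bsym, of "\<lambda>M. M $$ (0, j)"] B that n by simp
  define B' where "B' = mat n' n' (\<lambda>(i, j). B $$ (Suc i, Suc j))"
  have B': "B' \<in> carrier_mat n' n'" by (simp add: B'_def)
  define E where "E = mat 1 1 (\<lambda>_. e)"
  have E: "E \<in> carrier_mat 1 1" by (simp add: E_def)
  have Bblock: "B = four_block_mat E (0\<^sub>m 1 n') (0\<^sub>m n' 1) B'"
    by (rule eq_matI) (use B n' Bcol Brow in \<open>auto simp: E_def B'_def\<close>)
  have "similar_mat_wit B A ?Wt W"
    by (rule similar_mat_witI[of _ _ n]) (use W Wt WW A B in \<open>auto simp: B_def\<close>)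
  then have "char_poly B = char_poly A" by (intro char_poly_similar) (auto simp: similar_mat_def)
  also have "char_poly B = char_poly E * char_poly B'"
    unfolding Bblock by (rule char_poly_four_block_zeros_col[OF E _ B']) simp
  also have "char_poly E = [:- e, 1:]" by (simp add: E_def char_poly_defs det_def sign_def)
  \<comment> \<open>Cancelling the linear factor of the 1 x 1 block leaves the remaining roots in
    their given order, as the induction hypothesis expects.\<close>
  finally have cpB': "char_poly B' = (\<Prod>e\<leftarrow>es. [:- e, 1:])"
    unfolding cp by (metis mult_cancel_left pCons_eq_0_iff zero_neq_one)
  have "transpose_mat B' = B'"
  proof (rule eq_matI)
    fix i j assume "i < dim_row B'" "j < dim_col B'"
    then show "transpose_mat B' $$ (i, j) = B' $$ (i, j)"
      using arg_cong[OF Bsym, of "\<lambda>M. M $$ (Suc i, Suc j)"] B n' by (simp add: B'_def)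
  qed (use B' in auto)
  from Cons.IH[OF B' this cpB'] obtain U where U: "U \<in> carrier_mat n' n'" "transpose_mat U * U = 1\<^sub>m n'"
    "transpose_mat U * B' * U = mat n' n' (\<lambda>(i, j). if i = j then es ! i else 0)" by blast
  define F where "F = four_block_mat (1\<^sub>m 1) (0\<^sub>m 1 n') (0\<^sub>m n' 1) U"
  have F: "F \<in> carrier_mat n n" using U(1) unfolding F_def n' by (metis four_block_carrier_mat one_carrier_mat plus_1_eq_Suc)
  have Ft: "transpose_mat F = four_block_mat (1\<^sub>m 1) (0\<^sub>m 1 n') (0\<^sub>m n' 1) (transpose_mat U)"
    unfolding F_def using U(1) by (subst transpose_four_block_mat) auto
  have Ut: "transpose_mat U \<in> carrier_mat n' n'" using U(1) by simp
  have FF: "transpose_mat F * F = 1\<^sub>m n"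
    unfolding Ft unfolding F_def mult_block_diagonal_mat[OF one_carrier_mat Ut one_carrier_mat U(1)] U(2)
    by (simp add: n')
  have FBF: "transpose_mat F * B * F = mat n n (\<lambda>(i, j). if i = j then (e # es) ! i else 0)"
  proof -
    have "transpose_mat F * B = four_block_mat (1\<^sub>m 1 * E) (0\<^sub>m 1 n') (0\<^sub>m n' 1) (transpose_mat U * B')"
      unfolding Ft Bblock by (rule mult_block_diagonal_mat[OF one_carrier_mat Ut E B'])
    also have "1\<^sub>m 1 * E = E" using E by (rule left_mult_one_mat)
    finally have FB: "transpose_mat F * B = four_block_mat E (0\<^sub>m 1 n') (0\<^sub>m n' 1) (transpose_mat U * B')" .
    have "transpose_mat F * B * F = four_block_mat (E * 1\<^sub>m 1) (0\<^sub>m 1 n') (0\<^sub>m n' 1) (transpose_mat U * B' * U)"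
      unfolding FB unfolding F_def by (rule mult_block_diagonal_mat[OF E mult_carrier_mat[OF Ut B'] one_carrier_mat U(1)])
    also have "E * 1\<^sub>m 1 = E" using E by (rule right_mult_one_mat)
    finally have "transpose_mat F * B * F = four_block_mat E (0\<^sub>m 1 n') (0\<^sub>m n' 1) (transpose_mat U * B' * U)" .
    then show ?thesis unfolding U(3)
      by (intro eq_matI) (auto simp: E_def n' nth_Cons')
  qed
  have V: "W * F \<in> carrier_mat n n" using W F by simp
  have Vt: "transpose_mat (W * F) = transpose_mat F * ?Wt" using transpose_mult[OF W(1) F] .
  have Ftc: "transpose_mat F \<in> carrier_mat n n" using F by simp
  have "transpose_mat (W * F) * (W * F) = transpose_mat F * (?Wt * W * F)"
  proof -
    have "transpose_mat (W * F) * (W * F) = transpose_mat F * (?Wt * (W * F))"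
      unfolding Vt by (rule assoc_mult_mat[OF Ftc Wt V])
    then show ?thesis using assoc_mult_mat[OF Wt W(1) F] by simp
  qed
  also have "\<dots> = 1\<^sub>m n" unfolding W(2) using F FF by simp
  finally have 1: "transpose_mat (W * F) * (W * F) = 1\<^sub>m n" .
  have "transpose_mat (W * F) * A * (W * F) = transpose_mat F * B * F"
  proof -
    have c: "?Wt * A \<in> carrier_mat n n" "transpose_mat F * (?Wt * A) \<in> carrier_mat n n" using Wt A Ftc by auto
    have "transpose_mat (W * F) * A * (W * F) = transpose_mat F * (?Wt * A) * (W * F)"
      unfolding Vt assoc_mult_mat[OF Ftc Wt A] ..
    also have "\<dots> = transpose_mat F * (?Wt * A) * W * F" by (rule assoc_mult_mat[OF c(2) W(1) F, symmetric])
    also have "transpose_mat F * (?Wt * A) * W = transpose_mat F * B" unfolding B_def by (rule assoc_mult_mat[OF Ftc c(1) W(1)])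
    finally show ?thesis .
  qed
  then show ?case using V 1 FBF by (intro exI[of _ "W * F"]) simp
qed

text \<open>The eigenvalues are nonnegative because they are the squared lengths of the columns of A
  V; hence squaring undoes the root in \<open>singular_value\<close>. The shift by
  \<open>Suc\<close> reflects that singular values are indexed from 1.\<close>

lemma singular_value_diagonalization:
  assumes A: "A \<in> carrier_mat m n"
  shows "\<exists>V \<nu>. V \<in> carrier_mat n n \<and> transpose_mat V * V = 1\<^sub>m n \<and>
    transpose_mat V * (transpose_mat A * A) * V = mat n n (\<lambda>(i, j). if i = j then \<nu> i else 0) \<and>
    (\<forall>l<n. 0 \<le> \<nu> l \<and> \<nu> l = (singular_value A (Suc l))\<^sup>2)"
proof -
  define S where "S = transpose_mat A * A"
  have S: "S \<in> carrier_mat n n" using A by (simp add: S_def)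
  have "transpose_mat S = S" unfolding S_def using transpose_mult[of "transpose_mat A" n m A n] A by simp
  from real_symmetric_char_poly_splits[OF S this] obtain es0 where es0: "char_poly S = (\<Prod>e\<leftarrow>es0. [:- e, 1:])" by blast
  have pr: "proots (char_poly S) = mset es0"
  proof -
    have "proots (\<Prod>e\<leftarrow>es0. [:- e, 1:]) = mset es0" 
    proof (induction es0)
      case (Cons a es0)
      have "(\<Prod>e\<leftarrow>es0. [:- e, 1:]) \<noteq> (0 :: real poly)" by (auto simp: prod_list_zero_iff)
      then show ?case using proots_mult[of "[:- a, 1:]" "\<Prod>e\<leftarrow>es0. [:- e, 1:]"] Cons
        by (simp del: mult_pCons_left)
    qed simp
    then show ?thesis by (simp add: es0)
  qed
  define es where "es = rev (sorted_list_of_multiset (proots (char_poly S)))"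
  have ms: "mset es = mset es0" by (simp add: es_def pr)
  have es: "char_poly S = (\<Prod>e\<leftarrow>es. [:- e, 1:])"
    unfolding es0 by (simp only: prod_mset_prod_list[symmetric] mset_map ms)
  have len: "length es = n"
    using degree_monic_char_poly[OF S] degree_linear_factors[of uminus es] unfolding es by simp
  have mono: "es ! l' \<le> es ! l" if "l \<le> l'" "l' < n" for l l'
    using that len by (intro sorted_rev_nth_mono) (auto simp: es_def)
  obtain V where V: "V \<in> carrier_mat n n" "transpose_mat V * V = 1\<^sub>m n"
    and d: "transpose_mat V * S * V = mat n n (\<lambda>(i, j). if i = j then es ! i else 0)"
    using real_symmetric_diagonalization[OF S \<open>transpose_mat S = S\<close> es] by blast
  define U where "U = A * V"
  have U: "U \<in> carrier_mat m n" using A V by (simp add: U_def)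
  have UU: "(\<Sum>c<m. U $$ (c, i) * U $$ (c, j)) = (if i = j then es ! i else 0)" if "i < n" "j < n" for i j
  proof -
    have "transpose_mat U * U = transpose_mat V * S * V"
      unfolding U_def S_def by (rule transpose_mult_self[OF A V(1)])
    then have "(transpose_mat U * U) $$ (i, j) = (if i = j then es ! i else 0)" unfolding d using that by simp
    then show ?thesis using U that by (simp add: scalar_prod_def lessThan_atLeast0)
  qed
  have nn: "0 \<le> es ! l" if "l < n" for l
    using UU[OF that that] sum_nonneg[of "{..<m}" "\<lambda>c. U $$ (c, l) * U $$ (c, l)"] by simp
  \<comment> \<open>Beyond min m n the definition of \<open>singular_value\<close> returns 0, so the
    corresponding eigenvalues must be shown to vanish.\<close>
  have z: "es ! l = 0" if l: "m \<le> l" "l < n" for l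
  proof (rule ccontr)
    assume "es ! l \<noteq> 0"
    then have pos: "0 < es ! i" if "i \<le> m" for i
      using nn[OF l(2)] mono[of i l] that l by linarith
    \<comment> \<open>The first m + 1 columns of A V, padded with a zero row: a square singular
      matrix. By monotonicity its Gram matrix would be diagonal with positive entries, a
      contradiction.\<close>
    define P where "P = mat (Suc m) (Suc m) (\<lambda>(i, j). if i < m then U $$ (i, j) else 0)"
    have P: "P \<in> carrier_mat (Suc m) (Suc m)" by (simp add: P_def)
    have "transpose_mat P *\<^sub>v unit_vec (Suc m) m = 0\<^sub>v (Suc m)"
      by (rule eq_vecI) (auto simp: P_def)
    then have "det (transpose_mat P) = 0"
      using det_0_iff_vec_prod_zero[of "transpose_mat P" "Suc m"] P
      by (intro iffD2[OF det_0_iff_vec_prod_zero[of _ "Suc m"]] exI[of _ "unit_vec (Suc m) m"]) auto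
    then have det0: "det (transpose_mat P * P) = 0" using det_mult[of "transpose_mat P" "Suc m" P] P by simp
    have "transpose_mat P * P = mat (Suc m) (Suc m) (\<lambda>(i, j). if i = j then es ! i else 0)"
    proof (rule eq_matI)
      fix i j assume "i < dim_row (mat (Suc m) (Suc m) (\<lambda>(i, j). if i = j then es ! i else 0))"
        "j < dim_col (mat (Suc m) (Suc m) (\<lambda>(i, j). if i = j then es ! i else 0))"
      then have ij: "i < Suc m" "j < Suc m" by auto
      have "(transpose_mat P * P) $$ (i, j) = (\<Sum>c<Suc m. P $$ (c, i) * P $$ (c, j))"
        using P ij by (simp add: scalar_prod_def lessThan_atLeast0 del: sum.op_ivl_Suc)
      also have "\<dots> = (\<Sum>c<m. U $$ (c, i) * U $$ (c, j))" using ij by (simp add: P_def)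
      finally show "(transpose_mat P * P) $$ (i, j) = mat (Suc m) (Suc m) (\<lambda>(i, j). if i = j then es ! i else 0) $$ (i, j)"
        using UU[of i j] ij l by simp
    qed (use P in auto)
    then have "det (transpose_mat P * P) = (\<Prod>i\<leftarrow>[0..<Suc m]. es ! i)"
    proof -
      let ?D = "mat (Suc m) (Suc m) (\<lambda>(i, j). if i = j then es ! i else 0)"
      have "upper_triangular ?D" "?D \<in> carrier_mat (Suc m) (Suc m)" by auto
      from det_upper_triangular[OF this] have "det ?D = (\<Prod>i\<leftarrow>[0..<Suc m]. ?D $$ (i, i))"
        by (simp add: diag_mat_def del: upt_Suc)
      also have "map (\<lambda>i. ?D $$ (i, i)) [0..<Suc m] = map (\<lambda>i. es ! i) [0..<Suc m]"
        by (rule map_cong) auto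
      finally show ?thesis unfolding \<open>transpose_mat P * P = ?D\<close> .
    qed
    moreover have "(\<Prod>i\<leftarrow>[0..<Suc m]. es ! i) \<noteq> 0"
    proof
      assume "(\<Prod>i\<leftarrow>[0..<Suc m]. es ! i) = 0"
      then obtain i where "i < Suc m" "es ! i = 0" unfolding prod_list_zero_iff by (auto simp del: upt_Suc)
      then show False using pos[of i] by simp
    qed
    ultimately show False using det0 by simp
  qed
  have "es ! l = (singular_value A (Suc l))\<^sup>2" if "l < n" for l
    using z[of l] nn[OF that] that A by (auto simp: singular_value_def S_def[symmetric] es_def[symmetric])
  then show ?thesis using V d nn unfolding S_def by blast
qed

section \<open>The output of the algorithm as an orthogonal projection\<close>

text \<open>The last iteration alone decides: transposing B^T L_t = R_t^T D_t gives D R = L_t^T B,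
  and L_t L_t^T = I because L_t is square with orthonormal columns. Since t \<ge> 1, a last
  iteration exists.\<close>

lemma rcsvd_qr_residual:
  assumes A: "A \<in> carrier_mat m n" and O: "\<Omega> \<in> carrier_mat n (k + p)" and t: "1 \<le> t"
    and run: "rcsvd_qr A k p t \<Omega> L D R"
  obtains W C where "W \<in> carrier_mat m (k + p)" "transpose_mat W * W = 1\<^sub>m (k + p)" "C \<in> carrier_mat (k + p) (k + p)"
    "A * \<Omega> = W * C" "vec_space.col_space m W = vec_space.col_space m (A * \<Omega>)"
    "L * D * R = W * (transpose_mat W * A)"
proof -
  let ?r = "k + p"
  have AO: "A * \<Omega> \<in> carrier_mat m ?r" using A O by simp
  from run obtain W C B Ls Ts Ds Rh Rs where
    qr: "qr_factorization (A * \<Omega>) W C"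
    and cs: "vec_space.col_space (dim_row A) W = vec_space.col_space (dim_row A) (A * \<Omega>)"
    and B: "B = transpose_mat W * A" and R0: "Rs 0 = eye ?r (dim_col A)"
    and step: "\<And>j. j \<in> {1..t} \<Longrightarrow> qr_factorization (B * transpose_mat (Rs (j - 1))) (Ls j) (Ts j)"
      "\<And>j. j \<in> {1..t} \<Longrightarrow> qr_factorization (transpose_mat B * Ls j) (Rh j) (Ds j)"
      "\<And>j. j \<in> {1..t} \<Longrightarrow> Rs j = transpose_mat (Rh j)"
    and LDR: "L = W * Ls t" "D = transpose_mat (Ds t)" "R = Rs t"
    unfolding rcsvd_qr_def by blast
  have W: "W \<in> carrier_mat m ?r" "transpose_mat W * W = 1\<^sub>m ?r" and C: "C \<in> carrier_mat ?r ?r" and WC: "A * \<Omega> = W * C"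
    using qr carrier_matD[OF AO] unfolding qr_factorization_def orthonormal_columns_def by (metis carrier_matD(2))+
  have Bc: "B \<in> carrier_mat ?r n" unfolding B using W A by simp
  \<comment> \<open>A QR step fixes shapes only relative to its input, so the shapes are propagated
    by induction from the initial \<open>eye\<close>.\<close>
  have dims: "Ls j \<in> carrier_mat ?r ?r \<and> Rh j \<in> carrier_mat n ?r" if "j \<in> {1..t}" "dim_row (Rs (j - 1)) = ?r" for j
    using step(1,2)[OF that(1)] that(2) Bc by (auto simp: qr_factorization_def)
  have dimR: "dim_row (Rs j) = ?r" if "j \<le> t" for j
    using that
  proof (induction j)
    case 0
    then show ?case by (simp add: R0 eye_def)
  next
    case (Suc j)
    then show ?case using dims[of "Suc j"] step(3)[of "Suc j"] by auto
  qed
  have tt: "t \<in> {1..t}" using t by simp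
  have Lc: "Ls t \<in> carrier_mat ?r ?r" and Rc: "Rh t \<in> carrier_mat n ?r" using dims[OF tt] dimR[of "t - 1"] by auto
  have LL: "transpose_mat (Ls t) * Ls t = 1\<^sub>m ?r"
    using step(1)[OF tt] Lc by (auto simp: qr_factorization_def orthonormal_columns_def)
  then have LL': "Ls t * transpose_mat (Ls t) = 1\<^sub>m ?r"
    using mat_mult_left_right_inverse[of "transpose_mat (Ls t)" ?r "Ls t"] Lc by simp
  have Dc: "Ds t \<in> carrier_mat ?r ?r" and RD: "transpose_mat B * Ls t = Rh t * Ds t"
    using step(2)[OF tt] Lc by (auto simp: qr_factorization_def)
  have "transpose_mat (Ds t) * transpose_mat (Rh t) = transpose_mat (transpose_mat B * Ls t)"
    unfolding RD using transpose_mult[OF Rc Dc] by simp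
  also have "\<dots> = transpose_mat (Ls t) * B" using transpose_mult[of "transpose_mat B" n ?r "Ls t" ?r] Bc Lc by simp
  finally have DR: "transpose_mat (Ds t) * transpose_mat (Rh t) = transpose_mat (Ls t) * B" .
  have "L * D * R = W * Ls t * (transpose_mat (Ds t) * transpose_mat (Rh t))"
    unfolding LDR step(3)[OF tt] by (rule assoc_mult_mat[of _ m ?r _ ?r _ n]) (use W Lc Dc Rc in auto)
  also have "\<dots> = W * (Ls t * transpose_mat (Ls t) * B)"
  proof -
    have Lt: "transpose_mat (Ls t) \<in> carrier_mat ?r ?r" using Lc by simp
    have "W * Ls t * (transpose_mat (Ls t) * B) = W * (Ls t * (transpose_mat (Ls t) * B))"
      by (rule assoc_mult_mat[OF W(1) Lc mult_carrier_mat[OF Lt Bc]])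
    then show ?thesis unfolding DR assoc_mult_mat[OF Lc Lt Bc] .
  qed
  also have "\<dots> = W * (transpose_mat W * A)" unfolding LL' left_mult_one_mat[OF Bc] by (simp only: B)
  finally show thesis using that[OF W C WC] cs A by simp
qed

text \<open>Equality of the column spaces provides E with W = Y E, and E turns out to be the inverse
  of C. As Y^T Y = C^T C, its inverse is E E^T, and Y E E^T Y^T = W W^T.\<close>

lemma projection_eq_cramer_inverse:
  assumes Y: "Y \<in> carrier_mat m r" and W: "W \<in> carrier_mat m r" "transpose_mat W * W = 1\<^sub>m r"
    and C: "C \<in> carrier_mat r r" and YWC: "Y = W * C"
    and cs: "vec_space.col_space m W = vec_space.col_space m Y"
  shows "W * transpose_mat W = Y * cramer_inverse (transpose_mat Y * Y) * transpose_mat Y"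
proof -
  have "\<exists>x\<in>carrier_vec r. Y *\<^sub>v x = col W j" if "j < r" for j
  proof -
    have "col W j \<in> vec_space.col_space m W"
    proof -
      have "col W j = W *\<^sub>v unit_vec r j" using W(1) that by (intro eq_vecI) auto
      then show ?thesis unfolding vec_space.col_space_eq[OF W(1)] using W(1) that by auto
    qed
    then show ?thesis unfolding cs vec_space.col_space_eq[OF Y] using Y by auto
  qed
  then obtain x where x: "\<And>j. j < r \<Longrightarrow> x j \<in> carrier_vec r" "\<And>j. j < r \<Longrightarrow> Y *\<^sub>v x j = col W j" by metis
  define E where "E = mat_of_cols r (map x [0..<r])"
  have E: "E \<in> carrier_mat r r" unfolding E_def using mat_of_cols_carrier(1)[of r "map x [0..<r]"] by simp
  have colE: "col E j = x j" if "j < r" for j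
    unfolding E_def using that x(1)[OF that] by (subst col_mat_of_cols) auto
  have YE: "Y * E = W"
  proof (rule eq_matI)
    fix i j assume "i < dim_row W" "j < dim_col W"
    then have ij: "i < m" "j < r" using W by auto
    have "col (Y * E) j = col W j" using x(2)[OF ij(2)] col_mult2[OF Y E ij(2)] colE[OF ij(2)] by simp
    then show "(Y * E) $$ (i, j) = W $$ (i, j)"
      using ij Y E W by (metis carrier_matD(1,2) index_col index_mult_mat(2,3))
  qed (use Y E W in auto)
  have Wt: "transpose_mat W \<in> carrier_mat r m" and Ct: "transpose_mat C \<in> carrier_mat r r" using W C by auto
  \<comment> \<open>Inserting W^T W = I gives C E = W^T (W C) E = W^T Y E = W^T W = I.\<close>
  have "C * E = transpose_mat W * W * (C * E)" unfolding W(2) using C E by simp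
  also have "\<dots> = transpose_mat W * (Y * E)"
    unfolding YWC assoc_mult_mat[OF W(1) C E] by (rule assoc_mult_mat[OF Wt W(1) mult_carrier_mat[OF C E]])
  finally have CE: "C * E = 1\<^sub>m r" unfolding YE W(2) .
  have EC: "E * C = 1\<^sub>m r" by (rule mat_mult_left_right_inverse[OF C E CE])
  have ECt: "transpose_mat E * transpose_mat C = 1\<^sub>m r"
    using transpose_mult[OF C E] unfolding CE by simp
  let ?S = "transpose_mat Y * Y"
  have S: "?S \<in> carrier_mat r r" using Y by simp
  have SC: "?S = transpose_mat C * C"
  proof -
    have "?S = transpose_mat C * (transpose_mat W * W) * C" unfolding YWC by (rule transpose_mult_self[OF W(1) C])
    then show ?thesis unfolding W(2) using C by simp
  qed
  have "det C \<noteq> 0" using det_mult[OF C E] unfolding CE by auto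
  then have "det ?S \<noteq> 0" unfolding SC using det_mult[OF Ct C] C by (simp add: det_transpose)
  note K = cramer_inverse[OF S this]
  let ?K = "cramer_inverse ?S"
  have Et: "transpose_mat E \<in> carrier_mat r r" using E by simp
  have "transpose_mat E * (?S * ?K) = transpose_mat E" unfolding K(2) using Et by simp
  moreover have "transpose_mat E * (?S * ?K) = transpose_mat E * transpose_mat C * (C * ?K)"
  proof -
    have Kc: "?K \<in> carrier_mat r r" by (rule K(1))
    have "transpose_mat E * (?S * ?K) = transpose_mat E * (transpose_mat C * (C * ?K))"
      using assoc_mult_mat[OF Ct C Kc] SC by simp
    then show ?thesis unfolding assoc_mult_mat[OF Et Ct mult_carrier_mat[OF C Kc]] .
  qed
  ultimately have CK: "C * ?K = transpose_mat E" unfolding ECt using C K(1) by simp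
  have Yt: "transpose_mat Y \<in> carrier_mat r m" using Y by simp
  have "Y * ?K * transpose_mat Y = W * (C * ?K) * transpose_mat Y"
    using assoc_mult_mat[OF W(1) C K(1)] YWC by simp
  also have "\<dots> = W * (transpose_mat E * transpose_mat Y)" unfolding CK by (rule assoc_mult_mat[OF W(1) Et Yt])
  also have "transpose_mat E * transpose_mat Y = transpose_mat W" using transpose_mult[OF Y E] YE by simp
  finally show ?thesis ..
qed

section \<open>The expected error\<close>

text \<open>The error is built from arbitrary choices of factors and only agrees almost everywhere
  with a measurable function. Its preimages then differ from measurable sets by null sets, which the
  completion contains.\<close>

lemma completion_AE_integral:
  fixes f g :: "'a \<Rightarrow> real"
  assumes g: "integrable M g" and ae: "AE x in M. f x = g x"
  shows "integrable (completion M) f" "integral\<^sup>L (completion M) f = integral\<^sup>L M g"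
proof -
  have ae': "AE x in completion M. f x = g x" using ae by (rule AE_completion)
  have gm: "g \<in> borel_measurable (completion M)" using g by (intro measurable_completion) auto
  have fm: "f \<in> borel_measurable (completion M)"
  proof (rule measurableI)
    fix B :: "real set" assume B: "B \<in> sets borel"
    have "g -` B \<inter> space (completion M) \<in> sets (completion M)" using gm B by (rule measurable_sets)
    moreover have "AE x in completion M. x \<in> g -` B \<inter> space (completion M) \<longleftrightarrow> x \<in> f -` B \<inter> space (completion M)"
      using ae' by eventually_elim auto
    ultimately show "f -` B \<inter> space (completion M) \<in> sets (completion M)"
      using completion.in_sets_AE by blast
  qed simp
  have "integrable (completion M) g" using g by (simp add: integrable_completion)
  then show "integrable (completion M) f" using integrable_cong_AE[OF fm gm ae'] by simp
  show "integral\<^sup>L (completion M) f = integral\<^sup>L M g"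
    using integral_cong_AE[OF fm gm ae'] g by (simp add: integral_completion)
qed

text \<open>Independence and the marginal laws say that the family of entries has the product law,
  which transfers expectations to \<open>gaussian_product\<close>. The family is restricted to its
  index set because product spaces consist of extensional functions.\<close>

lemma gaussian_random_matrix_distr:
  assumes "prob_space M" and G: "gaussian_random_matrix M n r \<Omega>" and "0 < n" "0 < r"
  defines "X \<equiv> \<lambda>\<omega>. \<lambda>(i, j)\<in>{..<n} \<times> {..<r}. \<Omega> \<omega> $$ (i, j)"
  shows "X \<in> M \<rightarrow>\<^sub>M gaussian_product ({..<n} \<times> {..<r})"
    and "distr M (gaussian_product ({..<n} \<times> {..<r})) X = gaussian_product ({..<n} \<times> {..<r})"
proof -
  interpret prob_space M by fact
  let ?I = "{..<n} \<times> {..<r}"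
  let ?E = "\<lambda>(i, j) \<omega>. \<Omega> \<omega> $$ (i, j)"
  have d: "distributed M lborel (?E e) std_normal_density" if "e \<in> ?I" for e
    using G that by (auto simp: gaussian_random_matrix_def)
  have meas: "?E e \<in> borel_measurable M" if "e \<in> ?I" for e
    using distributed_measurable[OF d[OF that]] by simp
  have sets: "sets (gaussian_product ?I) = sets (Pi\<^sub>M ?I (\<lambda>_. borel))" by (intro sets_PiM_cong) auto
  have X: "X = (\<lambda>\<omega>. \<lambda>e\<in>?I. ?E e \<omega>)" by (auto simp: X_def fun_eq_iff)
  show "X \<in> M \<rightarrow>\<^sub>M gaussian_product ?I"
    unfolding measurable_cong_sets[OF refl sets] X using meas by (intro measurable_restrict) auto
  have "distr M (Pi\<^sub>M ?I (\<lambda>_. borel)) (\<lambda>\<omega>. \<lambda>e\<in>?I. ?E e \<omega>) = (\<Pi>\<^sub>M e\<in>?I. distr M borel (?E e))"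
  proof (rule iffD1[OF indep_vars_iff_distr_eq_PiM'])
    show "?I \<noteq> {}" using assms by auto
    show "indep_vars (\<lambda>_. borel) ?E ?I" using G by (simp add: gaussian_random_matrix_def)
  qed (rule meas)
  also have "\<dots> = gaussian_product ?I"
  proof (intro PiM_cong refl)
    fix e assume e: "e \<in> ?I"
    have "distr M borel (?E e) = distr M lborel (?E e)" by (intro distr_cong) auto
    then show "distr M borel (?E e) = std_normal_distribution"
      using distributed_distr_eq_density[OF d[OF e]] by simp
  qed
  finally show "distr M (gaussian_product ?I) X = gaussian_product ?I"
    unfolding X using distr_cong[OF refl sets refl] by metis
qed

lemma sketch_residual_le:
  assumes A: "A \<in> carrier_mat m n" and Om: "\<Omega> \<in> carrier_mat n r"
    and W: "W \<in> carrier_mat m r" "transpose_mat W * W = 1\<^sub>m r" and C: "C \<in> carrier_mat r r" and AWC: "A * \<Omega> = W * C"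
    and V: "V \<in> carrier_mat n n" "transpose_mat V * V = 1\<^sub>m n"
    and d: "transpose_mat V * (transpose_mat A * A) * V = mat n n (\<lambda>(i, j). if i = j then \<nu> i else 0)"
    and rr: "rotated_ridge k \<epsilon> n (\<lambda>l c. V $$ (c, l))"
  shows "(frobenius_norm (A - W * (transpose_mat W * A)))\<^sup>2
    \<le> rotated_ridge.residual k r \<epsilon> n (\<lambda>l c. V $$ (c, l)) \<nu> (\<lambda>(i, j)\<in>{..<n} \<times> {..<r}. \<Omega> $$ (i, j))"
proof -
  interpret rotated_ridge k r \<epsilon> n "\<lambda>l c. V $$ (c, l)" by fact
  let ?w = "\<lambda>(i, j)\<in>{..<n} \<times> {..<r}. \<Omega> $$ (i, j)"
  \<comment> \<open>The zero columns encode the projection onto the leading \<open>k\<close>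
    eigenvectors; followed by V^T this is the competitor for the best approximation from the range
    of the sketch.\<close>
  define Z where "Z = mat r n (\<lambda>(j, i). if i < k then pinv (rot ?w) j i else 0)"
  have Z: "Z \<in> carrier_mat r n" by (simp add: Z_def)
  have Vt: "transpose_mat V \<in> carrier_mat n n" using V by simp
  have VO: "(transpose_mat V * \<Omega>) $$ (l, j) = rot ?w l j" if "l < n" "j < r" for l j
    using that V(1) Om by (simp add: rot_def scalar_prod_def lessThan_atLeast0)
  have VOZ: "(transpose_mat V * \<Omega> * Z) $$ (l, i) = (if i < k then \<Sum>j<r. rot ?w l j * pinv (rot ?w) j i else 0)"
    if "l < n" "i < n" for l i
  proof -
    have c: "transpose_mat V * \<Omega> \<in> carrier_mat n r" using Vt Om by simp
    have "(transpose_mat V * \<Omega> * Z) $$ (l, i) = (\<Sum>j<r. (transpose_mat V * \<Omega>) $$ (l, j) * Z $$ (j, i))"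
      using that carrier_matD[OF c] carrier_matD[OF Z] by (subst index_mult_mat(1)) (simp_all add: scalar_prod_def lessThan_atLeast0)
    also have "\<dots> = (\<Sum>j<r. rot ?w l j * (if i < k then pinv (rot ?w) j i else 0))"
      using that by (intro sum.cong) (auto simp: VO[OF that(1)] Z_def)
    finally show ?thesis by simp
  qed
  have "(frobenius_norm (A - W * (transpose_mat W * A)))\<^sup>2 \<le> (frobenius_norm (A - W * C * (Z * transpose_mat V)))\<^sup>2"
    by (rule projection_residual_le[OF A W C]) (use Z V in auto)
  also have "\<dots> = (\<Sum>l<n. \<nu> l * (\<Sum>i<n. ((if l = i then 1 else 0) - (transpose_mat V * \<Omega> * Z) $$ (l, i))\<^sup>2))"
    unfolding AWC[symmetric] by (rule frobenius_norm_approximation[OF A V d Om Z])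
  also have "\<dots> = (\<Sum>l<n. \<nu> l * (\<Sum>i<n. ((if l = i then 1 else 0) - (if i < k then \<Sum>j<r. rot ?w l j * pinv (rot ?w) j i else 0))\<^sup>2))"
    using VOZ by (intro sum.cong refl arg_cong2[of _ _ _ _ "(*)"]) auto
  finally show ?thesis unfolding residual_eq .
qed

theorem theorem3:
  fixes A :: "real mat" and m n k p t :: nat
    and M :: "'w measure" and \<Omega> L D R :: "'w \<Rightarrow> real mat"
  assumes "A \<in> carrier_mat m n"
    and "k \<ge> 2" and "p \<ge> 2" and "k + p \<le> min m n" and "t \<ge> 1"
    and "prob_space M"
    and "gaussian_random_matrix M n (k + p) \<Omega>"
    and "AE \<omega> in M. vec_space.rank m (A * \<Omega> \<omega>) = k + p"
    and "AE \<omega> in M. rcsvd_qr A k p t (\<Omega> \<omega>) (L \<omega>) (D \<omega>) (R \<omega>)"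
  shows "integrable (completion M) (\<lambda>\<omega>. frobenius_norm (A - L \<omega> * D \<omega> * R \<omega>)) \<and>
    expectation_compl M (\<lambda>\<omega>. frobenius_norm (A - L \<omega> * D \<omega> * R \<omega>))
      \<le> sqrt (1 + real k / (real p - 1)) * sqrt (\<Sum>j=k+1..n. (singular_value A j)\<^sup>2)"
proof -
  interpret prob_space M by fact
  define r where "r = k + p"
  note A = assms(1) and G = assms(7)[folded r_def]
  obtain V \<nu> where V: "V \<in> carrier_mat n n" "transpose_mat V * V = 1\<^sub>m n"
    and d: "transpose_mat V * (transpose_mat A * A) * V = mat n n (\<lambda>(i, j). if i = j then \<nu> i else 0)"
    and \<nu>: "\<And>l. l < n \<Longrightarrow> 0 \<le> \<nu> l" "\<And>l. l < n \<Longrightarrow> \<nu> l = (singular_value A (Suc l))\<^sup>2"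
    using singular_value_diagonalization[OF A] by blast
  \<comment> \<open>Rebuilding \<Omega> with \<open>mat\<close> fixes its shape for every \<omega>,
    including those outside \<open>space M\<close>, as the measurability lemma demands.\<close>
  define Y where "Y \<omega> = A * mat n r (\<lambda>(i, j). \<Omega> \<omega> $$ (i, j))" for \<omega>
  define g where "g \<omega> = frobenius_norm (A - Y \<omega> * cramer_inverse (transpose_mat (Y \<omega>) * Y \<omega>) * transpose_mat (Y \<omega>) * A)" for \<omega>
  define X where "X \<omega> = (\<lambda>(i, j)\<in>{..<n} \<times> {..<r}. \<Omega> \<omega> $$ (i, j))" for \<omega>
  define \<tau> where "\<tau> = (\<Sum>l\<in>{k..<n}. \<nu> l)"
  \<comment> \<open>A crude bound on each leading eigenvalue suffices, since it occurs only with the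
    factor \<epsilon>.\<close>
  define \<Lambda> where "\<Lambda> = (\<Sum>l<n. \<nu> l)"
  have Yc: "Y \<omega> \<in> carrier_mat m r" for \<omega> using A by (simp add: Y_def)
  have \<Omega>c: "\<Omega> \<omega> \<in> carrier_mat n r" if "\<omega> \<in> space M" for \<omega>
    using G that by (simp add: gaussian_random_matrix_def)
  have Y: "Y \<omega> = A * \<Omega> \<omega>" if "\<omega> \<in> space M" for \<omega>
    unfolding Y_def using \<Omega>c[OF that] by (intro arg_cong[of _ _ "(*) A"] eq_matI) auto
  have \<Omega>m: "(\<lambda>\<omega>. \<Omega> \<omega> $$ (i, j)) \<in> borel_measurable M" if "i < n" "j < r" for i j
    using G that distributed_measurable[of M lborel "\<lambda>\<omega>. \<Omega> \<omega> $$ (i, j)"]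
    by (auto simp: gaussian_random_matrix_def)
  have gm: "g \<in> borel_measurable M"
    unfolding g_def
  proof (rule borel_measurable_projection_residual[OF A Yc])
    fix i j assume "i < m" "j < r"
    then show "(\<lambda>\<omega>. Y \<omega> $$ (i, j)) \<in> borel_measurable M"
      unfolding Y_def by (intro borel_measurable_mat_mult[where a = m and b = n and c = r]) (use A \<Omega>m in auto)
  qed
  have rr: "rotated_ridge k \<epsilon> n (\<lambda>l c. V $$ (c, l))" if "0 < \<epsilon>" for \<epsilon>
  proof
    fix l l' assume "l < n" "l' < n"
    then show "(\<Sum>c<n. V $$ (c, l) * V $$ (c, l')) = (if l = l' then 1 else 0)"
      using V(1) arg_cong[OF V(2), of "\<lambda>B. B $$ (l, l')"] by (simp add: scalar_prod_def lessThan_atLeast0)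
  qed (use that assms(4) in auto)
  \<comment> \<open>The pointwise bound holds for all \<epsilon> outside a single null set, because
    the run of the algorithm does not involve \<epsilon>.\<close>
  have run: "AE \<omega> in M. frobenius_norm (A - L \<omega> * D \<omega> * R \<omega>) = g \<omega> \<and>
    (\<forall>\<epsilon>>0. (g \<omega>)\<^sup>2 \<le> rotated_ridge.residual k r \<epsilon> n (\<lambda>l c. V $$ (c, l)) \<nu> (X \<omega>))"
    using assms(9) AE_space
  proof eventually_elim
    case (elim \<omega>)
    have \<Omega>: "\<Omega> \<omega> \<in> carrier_mat n (k + p)" using \<Omega>c[OF elim(2)] by (simp add: r_def)
    obtain W C where W: "W \<in> carrier_mat m r" "transpose_mat W * W = 1\<^sub>m r" and C: "C \<in> carrier_mat r r"
      and WC: "A * \<Omega> \<omega> = W * C" and cs: "vec_space.col_space m W = vec_space.col_space m (A * \<Omega> \<omega>)"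
      and LDR: "L \<omega> * D \<omega> * R \<omega> = W * (transpose_mat W * A)"
      using rcsvd_qr_residual[OF A \<Omega> assms(5) elim(1)] unfolding r_def by blast
    have "W * transpose_mat W = Y \<omega> * cramer_inverse (transpose_mat (Y \<omega>) * Y \<omega>) * transpose_mat (Y \<omega>)"
      by (rule projection_eq_cramer_inverse[OF Yc W C]) (use Y[OF elim(2)] WC cs in auto)
    then have g: "g \<omega> = frobenius_norm (A - W * (transpose_mat W * A))"
      unfolding g_def using W(1) A assoc_mult_mat[of W m r "transpose_mat W" m A n] by simp
    then show ?case
      using sketch_residual_le[OF A \<Omega>c[OF elim(2)] W C WC V d rr] unfolding LDR X_def by simp
  qed
  have nr: "0 < n" "0 < r" using assms(2,4) by (auto simp: r_def)
  have Xm: "X \<in> M \<rightarrow>\<^sub>M gaussian_product ({..<n} \<times> {..<r})"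
    and Xd: "distr M (gaussian_product ({..<n} \<times> {..<r})) X = gaussian_product ({..<n} \<times> {..<r})"
    using gaussian_random_matrix_distr[OF assms(6) G nr] unfolding X_def[abs_def] by auto
  have res: "integrable M (\<lambda>\<omega>. (g \<omega>)\<^sup>2) \<and>
    expectation (\<lambda>\<omega>. (g \<omega>)\<^sup>2) \<le> (1 + k / (real p - 1)) * \<tau> + \<epsilon> * (\<Lambda> * k / (real p - 1))" if \<epsilon>: "0 < \<epsilon>" for \<epsilon>
  proof -
    interpret rotated_ridge k r \<epsilon> n "\<lambda>l c. V $$ (c, l)" by (rule rr[OF \<epsilon>])
    have \<Lambda>: "0 \<le> \<Lambda>" "\<And>l. l < k \<Longrightarrow> \<nu> l \<le> \<Lambda>"
      unfolding \<Lambda>_def using \<nu>(1) k_le by (auto intro!: sum_nonneg member_le_sum)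
    have kr: "k + 2 \<le> r" using assms(3) by (simp add: r_def)
    have E: "integrable \<mu> (residual \<nu>)"
      "(\<integral>w. residual \<nu> w \<partial>\<mu>) \<le> (1 + k / (real r - real k - 1)) * (\<Sum>l\<in>{k..<n}. \<nu> l) + \<epsilon> * (\<Lambda> * k / (real r - real k - 1))"
      using expectation_residual[of \<nu> \<Lambda>] \<nu>(1) \<Lambda> kr by blast+
    have i: "integrable M (\<lambda>\<omega>. residual \<nu> (X \<omega>))"
      using E(1) integrable_distr_eq[OF Xm borel_measurable_integrable[OF E(1)]] unfolding Xd by simp
    have e: "expectation (\<lambda>\<omega>. residual \<nu> (X \<omega>)) = (\<integral>w. residual \<nu> w \<partial>\<mu>)"
      using integral_distr[OF Xm borel_measurable_integrable[OF E(1)]] unfolding Xd by simp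
    have le: "AE \<omega> in M. (g \<omega>)\<^sup>2 \<le> residual \<nu> (X \<omega>)" using run \<epsilon> by auto
    have g2: "integrable M (\<lambda>\<omega>. (g \<omega>)\<^sup>2)"
      by (rule Bochner_Integration.integrable_bound[OF i]) (use gm le in auto)
    have "expectation (\<lambda>\<omega>. (g \<omega>)\<^sup>2) \<le> expectation (\<lambda>\<omega>. residual \<nu> (X \<omega>))"
      by (rule integral_mono_AE[OF g2 i le])
    moreover have rp: "real r - real k - 1 = real p - 1" by (simp add: r_def)
    ultimately show ?thesis using g2 E(2) unfolding e \<tau>_def rp by simp
  qed
  have g2: "integrable M (\<lambda>\<omega>. (g \<omega>)\<^sup>2)" using res[of 1] by simp
  have Eg2: "expectation (\<lambda>\<omega>. (g \<omega>)\<^sup>2) \<le> (1 + k / (real p - 1)) * \<tau>"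
  proof (rule field_le_epsilon)
    fix e :: real assume e: "0 < e"
    define b where "b = \<Lambda> * k / (real p - 1)"
    have b: "0 \<le> b" unfolding b_def \<Lambda>_def using \<nu>(1) assms(3) by (auto intro!: divide_nonneg_nonneg mult_nonneg_nonneg sum_nonneg)
    \<comment> \<open>The regularisation is taken as e / (b + 1) instead of e / b, since
      \<open>b\<close> may be 0.\<close>
    have "e / (b + 1) * b \<le> e" using e b by (simp add: field_simps)
    then show "expectation (\<lambda>\<omega>. (g \<omega>)\<^sup>2) \<le> (1 + k / (real p - 1)) * \<tau> + e"
      using res[of "e / (b + 1)"] e b unfolding b_def[symmetric] by auto
  qed
  have g1: "integrable M g" by (rule square_integrable_imp_integrable[OF gm g2])
  \<comment> \<open>Nonnegativity of the variance passes from the mean square to the mean.\<close>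
  have "(expectation g)\<^sup>2 \<le> expectation (\<lambda>\<omega>. (g \<omega>)\<^sup>2)"
    using variance_eq[OF g1 g2] variance_positive[of g] by simp
  also note Eg2
  also have "\<tau> = (\<Sum>j=k+1..n. (singular_value A j)\<^sup>2)"
  proof -
    have "(\<Sum>j=k+1..n. (singular_value A j)\<^sup>2) = (\<Sum>j=Suc k..<Suc n. (singular_value A j)\<^sup>2)"
      by (intro sum.cong) auto
    also have "\<dots> = (\<Sum>l\<in>{k..<n}. (singular_value A (Suc l))\<^sup>2)" by (rule sum.shift_bounds_Suc_ivl)
    finally show ?thesis unfolding \<tau>_def using \<nu>(2) by simp
  qed
  finally have "expectation g \<le> sqrt ((1 + k / (real p - 1)) * (\<Sum>j=k+1..n. (singular_value A j)\<^sup>2))"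
    by (rule real_le_rsqrt)
  then show ?thesis
    using completion_AE_integral[OF g1, of "\<lambda>\<omega>. frobenius_norm (A - L \<omega> * D \<omega> * R \<omega>)"] run
    by (simp add: real_sqrt_mult)
qed

end
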